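(* Let $k\ge1$. If $n\ge k$ and $V$ is the natural representation of $\widetilde U=U_{r,s}(\mathfrak{gl}_n)$, with its standard basis $v_1,\dots,v_n$, then $V^{\otimes k}$ is a cyclic $\widetilde U$-module generated by $v_1\otimes\cdots\otimes v_k$.
   Context: $\mathbb K$ is an algebraically closed field, $n$ a positive integer, $r,s\in\mathbb K$ nonzero with $r\ne s$. Let $\epsilon_1,\dots,\epsilon_n$ be an orthonormal basis of a Euclidean space with inner product $\langle\ ,\ \rangle$, and $\alpha_j=\epsilon_j-\epsilon_{j+1}$ ($1\le j<n$). $\widetilde U=U_{r,s}(\mathfrak{gl}_n)$ is the unital associative $\mathbb K$-algebra generated by $e_j,f_j$ ($1\le j<n$) and $a_i^{\pm1},b_i^{\pm1}$ ($1\le i\le n$) with relations: (R1) the $a_i^{\pm1},b_j^{\pm1}$ all commute and $a_ia_i^{-1}=b_jb_j^{-1}=1$; (R2) $a_ie_j=r^{\langle\epsilon_i,\alpha_j\rangle}e_ja_i$, $a_if_j=r^{-\langle\epsilon_i,\alpha_j\rangle}f_ja_i$; (R3) $b_ie_j=s^{\langle\epsilon_i,\alpha_j\rangle}e_jb_i$, $b_if_j=s^{-\langle\epsilon_i,\alpha_j\rangle}f_jb_i$; (R4) $[e_i,f_j]=\frac{\delta_{i,j}}{r-s}(a_ib_{i+1}-a_{i+1}b_i)$; (R5) $[e_i,e_j]=[f_i,f_j]=0$ if $|i-j|>1$; (R6) $e_i^2e_{i+1}-(r+s)e_ie_{i+1}e_i+rs\,e_{i+1}e_i^2=0$ and $e_ie_{i+1}^2-(r+s)e_{i+1}e_ie_{i+1}+rs\,e_{i+1}^2e_i=0$;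 (R7) $f_i^2f_{i+1}-(r^{-1}+s^{-1})f_if_{i+1}f_i+r^{-1}s^{-1}f_{i+1}f_i^2=0$ and $f_if_{i+1}^2-(r^{-1}+s^{-1})f_{i+1}f_if_{i+1}+r^{-1}s^{-1}f_{i+1}^2f_i=0$. Put $\omega_j=a_jb_{j+1}$, $\omega_j'=a_{j+1}b_j$ ($1\le j<n$). Hopf structure: $a_i^{\pm1},b_i^{\pm1}$ are group-like, $\Delta(e_i)=e_i\otimes1+\omega_i\otimes e_i$, $\Delta(f_i)=1\otimes f_i+f_i\otimes\omega_i'$, $\varepsilon(e_i)=\varepsilon(f_i)=0$, $S(e_i)=-\omega_i^{-1}e_i$, $S(f_i)=-f_i(\omega_i')^{-1}$; tensor powers of modules are formed via $\Delta$. The natural module $V$ has basis $v_1,\dots,v_n$; with $E_{i,j}$ the matrix units ($E_{i,j}v_l=\delta_{j,l}v_i$), $e_j=E_{j,j+1}$, $f_j=E_{j+1,j}$, $a_i=rE_{i,i}+\sum_{l\ne i}E_{l,l}$, $b_i=sE_{i,i}+\sum_{l\ne i}E_{l,l}$. *)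

theory Defs
  imports
    "HOL-Algebra.QuotRing"
    "HOL-Algebra.Module"
    "HOL-Computational_Algebra.Polynomial"
    "HOL-Library.Poly_Mapping"
    "HOL-Library.Product_Plus"
begin

section \<open>Free vector spaces and free algebras\<close>

text \<open>The free vector space with basis \<open>'i\<close> over a field \<open>'k\<close> is the type
  \<open>'i \<Rightarrow>\<^sub>0 'k\<close> of finitely supported functions. When \<open>'i\<close> is a monoid, the
  multiplication of \<open>Poly_Mapping\<close> makes it the monoid algebra; this requires the
  monoid to be written additively, so concatenation of words is written \<open>+\<close> and the empty
  word \<open>0\<close>.\<close>

datatype 'g word = Word (letters: "'g list")

instantiation word :: (type) monoid_add
begin

definition zero_word :: "'a word" where
  "0 = Word []"

definition plus_word :: "'a word \<Rightarrow> 'a word \<Rightarrow> 'a word" where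
  "u + w = Word (letters u @ letters w)"

instance
  by standard (simp_all add: zero_word_def plus_word_def)

end

definition basis_vec :: "'i \<Rightarrow> 'i \<Rightarrow>\<^sub>0 'k::field" where
  "basis_vec i = Poly_Mapping.single i 1"

definition scale :: "'k::field \<Rightarrow> ('i \<Rightarrow>\<^sub>0 'k) \<Rightarrow> 'i \<Rightarrow>\<^sub>0 'k" where
  "scale c x = Poly_Mapping.map ((*) c) x"

definition lin_ext :: "('i \<Rightarrow> 'j \<Rightarrow>\<^sub>0 'k::field) \<Rightarrow> ('i \<Rightarrow>\<^sub>0 'k) \<Rightarrow> 'j \<Rightarrow>\<^sub>0 'k" where
  "lin_ext h x = (\<Sum>i\<in>Poly_Mapping.keys x. scale (Poly_Mapping.lookup x i) (h i))"

text \<open>If \<open>X\<close> and \<open>Y\<close> have bases indexed by \<open>'i\<close> and \<open>'j\<close> and \<open>h\<close> encodes pairs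
  of indices, then \<open>tens h x y\<close> is \<open>x \<otimes> y\<close> in the space with basis
  \<open>h i j\<close>. It is used with \<open>h = Pair\<close>, and with \<open>h = (#)\<close> for iterated
  tensor products, whose bases are indexed by lists.\<close>

definition tens ::
    "('i \<Rightarrow> 'j \<Rightarrow> 'l) \<Rightarrow> ('i \<Rightarrow>\<^sub>0 'k::field) \<Rightarrow> ('j \<Rightarrow>\<^sub>0 'k) \<Rightarrow> 'l \<Rightarrow>\<^sub>0 'k" where
  "tens h x y = lin_ext (\<lambda>i. lin_ext (\<lambda>j. basis_vec (h i j)) y) x"

text \<open>The free algebra on a set of generators \<open>G\<close>, as a subring of the free algebra on the
  whole type; scalars \<open>c\<close> are embedded as \<open>Poly_Mapping.single 0 c\<close>.\<close>

definition free_alg :: "'g set \<Rightarrow> ('g word \<Rightarrow>\<^sub>0 'k::field) ring" where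
  "free_alg G =
    \<lparr>carrier = {p. \<forall>w\<in>Poly_Mapping.keys p. set (letters w) \<subseteq> G},
     monoid.mult = (*), one = 1, zero = 0, add = (+)\<rparr>"

section \<open>The algebra\<close>

text \<open>\<open>GAi i\<close> and \<open>GBi i\<close> are the formal inverses of \<open>GA i\<close> and \<open>GB i\<close>.\<close>

datatype gen = GE nat | GF nat | GA nat | GAi nat | GB nat | GBi nat

type_synonym 'k falg = "gen word \<Rightarrow>\<^sub>0 'k"

definition gens :: "nat \<Rightarrow> gen set" where
  "gens n = GE ` {1..<n} \<union> GF ` {1..<n} \<union> GA ` {1..n} \<union> GAi ` {1..n} \<union> GB ` {1..n} \<union> GBi ` {1..n}"

definition torus_gens :: "nat \<Rightarrow> gen set" where
  "torus_gens n = GA ` {1..n} \<union> GAi ` {1..n} \<union> GB ` {1..n} \<union> GBi ` {1..n}"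

definition gelt :: "gen \<Rightarrow> 'k::field falg" where
  "gelt g = basis_vec (Word [g])"

definition scal :: "'k::field \<Rightarrow> 'k falg" where
  "scal c = Poly_Mapping.single 0 c"

text \<open>\<open>\<langle>\<epsilon>\<^sub>i, \<alpha>\<^sub>j\<rangle> = \<langle>\<epsilon>\<^sub>i, \<epsilon>\<^sub>j\<rangle> - \<langle>\<epsilon>\<^sub>i, \<epsilon>\<^sub>j\<^sub>+\<^sub>1\<rangle>\<close> for orthonormal
  \<open>\<epsilon>\<close>.\<close>

definition eps_alpha :: "nat \<Rightarrow> nat \<Rightarrow> int" where
  "eps_alpha i j = of_bool (i = j) - of_bool (i = j + 1)"

inductive defrel :: "nat \<Rightarrow> 'k::field \<Rightarrow> 'k \<Rightarrow> 'k falg \<Rightarrow> 'k falg \<Rightarrow> bool"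
  for n :: nat and r s :: 'k
where
  R1_comm: "\<lbrakk>x \<in> torus_gens n; y \<in> torus_gens n\<rbrakk> \<Longrightarrow>
    defrel n r s (gelt x * gelt y) (gelt y * gelt x)"
| R1_a: "i \<in> {1..n} \<Longrightarrow> defrel n r s (gelt (GA i) * gelt (GAi i)) 1"
| R1_b: "i \<in> {1..n} \<Longrightarrow> defrel n r s (gelt (GB i) * gelt (GBi i)) 1"
| R2_e: "\<lbrakk>i \<in> {1..n}; j \<in> {1..<n}\<rbrakk> \<Longrightarrow>
    defrel n r s (gelt (GA i) * gelt (GE j)) (scal (r powi eps_alpha i j) * gelt (GE j) * gelt (GA i))"
| R2_f: "\<lbrakk>i \<in> {1..n}; j \<in> {1..<n}\<rbrakk> \<Longrightarrow>
    defrel n r s (gelt (GA i) * gelt (GF j)) (scal (r powi (- eps_alpha i j)) * gelt (GF j) * gelt (GA i))"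
| R3_e: "\<lbrakk>i \<in> {1..n}; j \<in> {1..<n}\<rbrakk> \<Longrightarrow>
    defrel n r s (gelt (GB i) * gelt (GE j)) (scal (s powi eps_alpha i j) * gelt (GE j) * gelt (GB i))"
| R3_f: "\<lbrakk>i \<in> {1..n}; j \<in> {1..<n}\<rbrakk> \<Longrightarrow>
    defrel n r s (gelt (GB i) * gelt (GF j)) (scal (s powi (- eps_alpha i j)) * gelt (GF j) * gelt (GB i))"
| R4: "\<lbrakk>i \<in> {1..<n}; j \<in> {1..<n}\<rbrakk> \<Longrightarrow>
    defrel n r s (gelt (GE i) * gelt (GF j) - gelt (GF j) * gelt (GE i))
      (scal (of_bool (i = j) / (r - s)) * (gelt (GA i) * gelt (GB (i+1)) - gelt (GA (i+1)) * gelt (GB i)))"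
| R5_e: "\<lbrakk>i \<in> {1..<n}; j \<in> {1..<n}; \<bar>int i - int j\<bar> > 1\<rbrakk> \<Longrightarrow>
    defrel n r s (gelt (GE i) * gelt (GE j) - gelt (GE j) * gelt (GE i)) 0"
| R5_f: "\<lbrakk>i \<in> {1..<n}; j \<in> {1..<n}; \<bar>int i - int j\<bar> > 1\<rbrakk> \<Longrightarrow>
    defrel n r s (gelt (GF i) * gelt (GF j) - gelt (GF j) * gelt (GF i)) 0"
| R6_1: "\<lbrakk>i \<in> {1..<n}; i + 1 \<in> {1..<n}\<rbrakk> \<Longrightarrow>
    defrel n r s (gelt (GE i) ^ 2 * gelt (GE (i+1)) - scal (r + s) * gelt (GE i) * gelt (GE (i+1)) * gelt (GE i)
      + scal (r * s) * gelt (GE (i+1)) * gelt (GE i) ^ 2) 0"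
| R6_2: "\<lbrakk>i \<in> {1..<n}; i + 1 \<in> {1..<n}\<rbrakk> \<Longrightarrow>
    defrel n r s (gelt (GE i) * gelt (GE (i+1)) ^ 2 - scal (r + s) * gelt (GE (i+1)) * gelt (GE i) * gelt (GE (i+1))
      + scal (r * s) * gelt (GE (i+1)) ^ 2 * gelt (GE i)) 0"
| R7_1: "\<lbrakk>i \<in> {1..<n}; i + 1 \<in> {1..<n}\<rbrakk> \<Longrightarrow>
    defrel n r s (gelt (GF i) ^ 2 * gelt (GF (i+1))
      - scal (inverse r + inverse s) * gelt (GF i) * gelt (GF (i+1)) * gelt (GF i)
      + scal (inverse r * inverse s) * gelt (GF (i+1)) * gelt (GF i) ^ 2) 0"
| R7_2: "\<lbrakk>i \<in> {1..<n}; i + 1 \<in> {1..<n}\<rbrakk> \<Longrightarrow>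
    defrel n r s (gelt (GF i) * gelt (GF (i+1)) ^ 2
      - scal (inverse r + inverse s) * gelt (GF (i+1)) * gelt (GF i) * gelt (GF (i+1))
      + scal (inverse r * inverse s) * gelt (GF (i+1)) ^ 2 * gelt (GF i)) 0"

definition rel_ideal :: "nat \<Rightarrow> 'k::field \<Rightarrow> 'k \<Rightarrow> 'k falg set" where
  "rel_ideal n r s = genideal (free_alg (gens n)) {p - q | p q. defrel n r s p q}"

definition U_gl :: "nat \<Rightarrow> 'k::field \<Rightarrow> 'k \<Rightarrow> 'k falg set ring" where
  "U_gl n r s = free_alg (gens n) Quot rel_ideal n r s"

section \<open>Comultiplication and counit\<close>

text \<open>Both are given as algebra homomorphisms on the free algebra \<open>\<F>\<close>; the tensor square of
  \<open>\<F>\<close> is the monoid algebra of pairs of words. They are compatible with the defining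
  relations and so describe the structure maps of the quotient.\<close>

definition alg_ext :: "('g \<Rightarrow> 'm::monoid_add \<Rightarrow>\<^sub>0 'k::field) \<Rightarrow> ('g word \<Rightarrow>\<^sub>0 'k) \<Rightarrow> 'm \<Rightarrow>\<^sub>0 'k" where
  "alg_ext h = lin_ext (\<lambda>w. prod_list (map h (letters w)))"

definition omega :: "nat \<Rightarrow> 'k::field falg" where
  "omega j = gelt (GA j) * gelt (GB (j+1))"

definition omega' :: "nat \<Rightarrow> 'k::field falg" where
  "omega' j = gelt (GA (j+1)) * gelt (GB j)"

fun comult_gen :: "gen \<Rightarrow> gen word \<times> gen word \<Rightarrow>\<^sub>0 'k::field" where
  "comult_gen (GE i) = tens Pair (gelt (GE i)) 1 + tens Pair (omega i) (gelt (GE i))"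
| "comult_gen (GF i) = tens Pair 1 (gelt (GF i)) + tens Pair (gelt (GF i)) (omega' i)"
| "comult_gen g = tens Pair (gelt g) (gelt g)"

definition comult :: "'k::field falg \<Rightarrow> gen word \<times> gen word \<Rightarrow>\<^sub>0 'k" where
  "comult = alg_ext comult_gen"

fun counit_gen :: "gen \<Rightarrow> 'k::field" where
  "counit_gen (GE i) = 0"
| "counit_gen (GF i) = 0"
| "counit_gen _ = 1"

definition counit :: "'k::field falg \<Rightarrow> 'k" where
  "counit p = (\<Sum>w\<in>Poly_Mapping.keys p.
     Poly_Mapping.lookup p w * prod_list (map counit_gen (letters w)))"

section \<open>The natural module and its tensor powers\<close>

text \<open>\<open>munit i j\<close> is the matrix unit \<open>E\<^sub>i\<^sub>,\<^sub>j\<close>, and \<open>basis_vec l\<close> is \<open>v\<^sub>l\<close>.\<close>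

definition munit :: "nat \<Rightarrow> nat \<Rightarrow> (nat \<Rightarrow>\<^sub>0 'k::field) \<Rightarrow> nat \<Rightarrow>\<^sub>0 'k" where
  "munit i j = lin_ext (\<lambda>l. if j = l then basis_vec i else 0)"

definition diag_op :: "nat \<Rightarrow> 'k::field \<Rightarrow> nat \<Rightarrow> (nat \<Rightarrow>\<^sub>0 'k) \<Rightarrow> nat \<Rightarrow>\<^sub>0 'k" where
  "diag_op n c i x = scale c (munit i i x) + (\<Sum>l\<in>{1..n} - {i}. munit l l x)"

fun nat_gen :: "nat \<Rightarrow> 'k::field \<Rightarrow> 'k \<Rightarrow> gen \<Rightarrow> (nat \<Rightarrow>\<^sub>0 'k) \<Rightarrow> nat \<Rightarrow>\<^sub>0 'k" where
  "nat_gen n r s (GE j) = munit j (j+1)"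
| "nat_gen n r s (GF j) = munit (j+1) j"
| "nat_gen n r s (GA i) = diag_op n r i"
| "nat_gen n r s (GAi i) = diag_op n (inverse r) i"
| "nat_gen n r s (GB i) = diag_op n s i"
| "nat_gen n r s (GBi i) = diag_op n (inverse s) i"

definition nat_act :: "nat \<Rightarrow> 'k::field \<Rightarrow> 'k \<Rightarrow> 'k falg \<Rightarrow> (nat \<Rightarrow>\<^sub>0 'k) \<Rightarrow> nat \<Rightarrow>\<^sub>0 'k" where
  "nat_act n r s p x = lin_ext (\<lambda>w. foldr (nat_gen n r s) (letters w) x) p"

text \<open>For linear \<open>S\<close> on the span of the basis \<open>'i\<close> and \<open>T\<close> on the span of the basis
  \<open>'i list\<close>, \<open>tens_op S T\<close> is the linear map \<open>S \<otimes> T\<close>.\<close>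

definition tens_op ::
    "(('i \<Rightarrow>\<^sub>0 'k::field) \<Rightarrow> 'i \<Rightarrow>\<^sub>0 'k) \<Rightarrow> (('i list \<Rightarrow>\<^sub>0 'k) \<Rightarrow> 'i list \<Rightarrow>\<^sub>0 'k)
      \<Rightarrow> ('i list \<Rightarrow>\<^sub>0 'k) \<Rightarrow> 'i list \<Rightarrow>\<^sub>0 'k" where
  "tens_op S T = lin_ext (\<lambda>is. case is of [] \<Rightarrow> 0
     | i # js \<Rightarrow> tens (#) (S (basis_vec i)) (T (basis_vec js)))"

text \<open>The action of the free algebra on \<open>V\<^sup>\<otimes>\<^sup>k\<close>, where \<open>V\<^sup>\<otimes>\<^sup>0\<close> is the trivial module and
  \<open>V\<^sup>\<otimes>\<^sup>k\<^sup>+\<^sup>1 = V \<otimes> V\<^sup>\<otimes>\<^sup>k\<close>.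
  The basis vector indexed by the list \<open>[i\<^sub>1, \<dots>, i\<^sub>k]\<close> is
  \<open>v\<^bsub>i\<^sub>1\<^esub> \<otimes> \<cdots> \<otimes> v\<^bsub>i\<^sub>k\<^esub>\<close>.\<close>

primrec tpow_act ::
    "nat \<Rightarrow> 'k::field \<Rightarrow> 'k \<Rightarrow> nat \<Rightarrow> 'k falg \<Rightarrow> (nat list \<Rightarrow>\<^sub>0 'k) \<Rightarrow> nat list \<Rightarrow>\<^sub>0 'k" where
  "tpow_act n r s 0 p x = scale (counit p) x"
| "tpow_act n r s (Suc k) p x =
    lin_ext (\<lambda>(u, w).
      tens_op (nat_act n r s (basis_vec u)) (tpow_act n r s k (basis_vec w)) x) (comult p)"

text \<open>A coset \<open>Q\<close> in the quotient algebra acts by the common value of its representatives; as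
  for the maps induced by homomorphisms in \<open>QuotRing\<close>, \<open>the_elem\<close> is meaningful only if
  that value is unique. The fields \<open>mult\<close> and \<open>one\<close> of the record play no role.\<close>

definition tensor_power ::
    "nat \<Rightarrow> 'k::field \<Rightarrow> 'k \<Rightarrow> nat \<Rightarrow> ('k falg set, nat list \<Rightarrow>\<^sub>0 'k) module" where
  "tensor_power n r s k =
    \<lparr>carrier = {x. \<forall>is\<in>Poly_Mapping.keys x. length is = k \<and> set is \<subseteq> {1..n}},
     monoid.mult = undefined, one = undefined, zero = 0, add = (+),
     module.smult = (\<lambda>Q x. the_elem ((\<lambda>p. tpow_act n r s k p x) ` Q))\<rparr>"

definition pure_tensor :: "(nat \<Rightarrow>\<^sub>0 'k::field) list \<Rightarrow> nat list \<Rightarrow>\<^sub>0 'k" where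
  "pure_tensor xs = foldr (tens (#)) xs (basis_vec [])"

section \<open>Modules over a noncommutative ring\<close>

text \<open>The axioms are those of the locale \<open>module\<close>, which however insists on a commutative
  base ring.\<close>

locale left_module = R?: ring R + M?: abelian_group M for R and M (structure) +
  assumes smult_closed: "\<lbrakk>a \<in> carrier R; x \<in> carrier M\<rbrakk> \<Longrightarrow> a \<odot>\<^bsub>M\<^esub> x \<in> carrier M"
    and smult_l_distr: "\<lbrakk>a \<in> carrier R; b \<in> carrier R; x \<in> carrier M\<rbrakk> \<Longrightarrow>
      (a \<oplus>\<^bsub>R\<^esub> b) \<odot>\<^bsub>M\<^esub> x = a \<odot>\<^bsub>M\<^esub> x \<oplus>\<^bsub>M\<^esub> b \<odot>\<^bsub>M\<^esub> x"
    and smult_r_distr: "\<lbrakk>a \<in> carrier R; x \<in> carrier M; y \<in> carrier M\<rbrakk> \<Longrightarrow>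
      a \<odot>\<^bsub>M\<^esub> (x \<oplus>\<^bsub>M\<^esub> y) = a \<odot>\<^bsub>M\<^esub> x \<oplus>\<^bsub>M\<^esub> a \<odot>\<^bsub>M\<^esub> y"
    and smult_assoc: "\<lbrakk>a \<in> carrier R; b \<in> carrier R; x \<in> carrier M\<rbrakk> \<Longrightarrow>
      (a \<otimes>\<^bsub>R\<^esub> b) \<odot>\<^bsub>M\<^esub> x = a \<odot>\<^bsub>M\<^esub> (b \<odot>\<^bsub>M\<^esub> x)"
    and smult_one: "x \<in> carrier M \<Longrightarrow> \<one>\<^bsub>R\<^esub> \<odot>\<^bsub>M\<^esub> x = x"

definition cyclic_module_generated_by ::
    "('a, 'c) ring_scheme \<Rightarrow> ('a, 'b, 'd) module_scheme \<Rightarrow> 'b \<Rightarrow> bool" where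
  "cyclic_module_generated_by R M x \<longleftrightarrow>
    left_module R M \<and> x \<in> carrier M \<and> carrier M = {a \<odot>\<^bsub>M\<^esub> x | a. a \<in> carrier R}"

end

theory Submission
  imports Defs "HOL-Combinatorics.Permutations"
begin

text \<open>
  A representation of the generators in a corner \<open>u End(V) u\<close> which satisfies the relations with \<open>u\<close> for the
  unit can be tensored with another one: on \<open>V \<otimes> W\<close> the two summands of \<open>\<Delta>(e\<^sub>i)\<close> and \<open>\<Delta>(e\<^sub>j)\<close> commute up
  to scalars, and these scalars make the mixed terms of the Serre relations cancel. Hence the free
  algebra acts on \<open>V\<^sup>\<otimes>\<^sup>k\<close> through the quotient.

  For the cyclicity, \<open>e\<^sub>j\<close> sends a tensor of basis vectors in which \<open>v\<^bsub>j+1\<^esub>\<close> occurs exactly once to a nonzero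
  multiple of the tensor with \<open>v\<^sub>j\<close> at that place, and similarly for \<open>f\<^sub>j\<close>; if both \<open>v\<^sub>j\<close> and
  \<open>v\<^bsub>j+1\<^esub>\<close> occur exactly once, \<open>f\<^sub>j e\<^sub>j\<close> yields the tensor with the two exchanged. Exchanges produce
  \<open>v\<^sub>\<pi>\<^sub>(\<^sub>1\<^sub>) \<otimes> \<cdots> \<otimes> v\<^sub>\<pi>\<^sub>(\<^sub>k\<^sub>)\<close> for all permutations, and every tensor of basis vectors
  arises from one of these by moving one letter at a time.
\<close>

section \<open>Linear extension\<close>

lemma lookup_scale [simp]: "Poly_Mapping.lookup (scale c x) i = c * Poly_Mapping.lookup x i"
  by (simp add: scale_def Poly_Mapping.map.rep_eq when_def)

global_interpretation scale: vector_space "scale :: 'k::field \<Rightarrow> ('i \<Rightarrow>\<^sub>0 'k) \<Rightarrow> _"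
  by unfold_locales (rule poly_mapping_eqI, simp add: lookup_add algebra_simps)+

abbreviation lin :: "(('i \<Rightarrow>\<^sub>0 'k::field) \<Rightarrow> 'j \<Rightarrow>\<^sub>0 'k) \<Rightarrow> bool" where
  "lin \<equiv> Vector_Spaces.linear scale scale"

lemma linI:
  assumes "\<And>x y. f (x + y) = f x + f y" and "\<And>c x. f (scale c x) = scale c (f x)"
  shows "lin f"
  using assms by (simp add: Vector_Spaces.linear_iff scale.vector_space_axioms)

lemma linD:
  assumes "lin f"
  shows lin_add: "f (x + y) = f x + f y" and lin_scale: "f (scale c x) = scale c (f x)"
    and lin_zero: "f 0 = 0" and lin_minus: "f (x - y) = f x - f y"
    and lin_sum: "f (sum g S) = (\<Sum>a\<in>S. f (g a))"
proof -
  interpret module_hom scale scale f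
    using assms by (rule module_hom_linearI)
  show "f (x + y) = f x + f y" "f (scale c x) = scale c (f x)" "f 0 = 0" "f (x - y) = f x - f y"
    "f (sum g S) = (\<Sum>a\<in>S. f (g a))"
    by (simp_all add: add scale diff sum)
qed

lemma single_eq_scale: "Poly_Mapping.single i c = scale c (basis_vec i)"
  by (rule poly_mapping_eqI) (simp add: basis_vec_def lookup_single when_def)

lemma basis_expansion:
  "x = (\<Sum>i\<in>Poly_Mapping.keys x. scale (Poly_Mapping.lookup x i) (basis_vec i))"
  by (rule poly_mapping_eqI)
    (auto simp: lookup_sum basis_vec_def lookup_single when_def if_distrib not_in_keys_iff_lookup_eq_zero cong: if_cong)

lemma lin_expand:
  assumes "lin f"
  shows "f x = lin_ext (\<lambda>i. f (basis_vec i)) x"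
proof -
  have "f x = f (\<Sum>i\<in>Poly_Mapping.keys x. scale (Poly_Mapping.lookup x i) (basis_vec i))"
    using basis_expansion[of x] by simp
  then show ?thesis
    by (simp add: lin_ext_def lin_sum[OF assms] lin_scale[OF assms])
qed

text \<open>Keys can cancel in a sum, so additivity of \<open>lin_ext\<close> is proved over one
  finite set that contains the supports of both summands.\<close>

lemma lin_ext_superset:
  assumes "finite S" and "Poly_Mapping.keys x \<subseteq> S"
  shows "lin_ext h x = (\<Sum>i\<in>S. scale (Poly_Mapping.lookup x i) (h i))"
  unfolding lin_ext_def
  by (rule sum.mono_neutral_left) (use assms in \<open>auto simp: not_in_keys_iff_lookup_eq_zero\<close>)

lemma lin_lin_ext:
  fixes h :: "'i \<Rightarrow> 'j \<Rightarrow>\<^sub>0 'k::field"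
  shows "lin (lin_ext h)"
proof (rule linI)
  fix x y :: "'i \<Rightarrow>\<^sub>0 'k" and c
  let ?S = "Poly_Mapping.keys x \<union> Poly_Mapping.keys y"
  have "lin_ext h (x + y) = (\<Sum>i\<in>?S. scale (Poly_Mapping.lookup (x + y) i) (h i))"
    by (rule lin_ext_superset) (auto simp: Poly_Mapping.keys_add)
  also have "\<dots> = (\<Sum>i\<in>?S. scale (Poly_Mapping.lookup x i) (h i))
      + (\<Sum>i\<in>?S. scale (Poly_Mapping.lookup y i) (h i))"
    by (simp add: lookup_add scale.scale_left_distrib sum.distrib)
  also have "\<dots> = lin_ext h x + lin_ext h y"
    by (subst (1 2) lin_ext_superset[of ?S]) auto
  finally show "lin_ext h (x + y) = lin_ext h x + lin_ext h y" .
  have "lin_ext h (scale c x) = (\<Sum>i\<in>Poly_Mapping.keys x. scale (c * Poly_Mapping.lookup x i) (h i))"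
    by (subst lin_ext_superset[of "Poly_Mapping.keys x"]) (auto simp: in_keys_iff)
  then show "lin_ext h (scale c x) = scale c (lin_ext h x)"
    by (simp add: lin_ext_def scale.scale_sum_right)
qed

lemmas lin_ext_simps [simp] = linD[OF lin_lin_ext]

lemma lin_ext_basis [simp]: "lin_ext h (basis_vec i) = h i"
  by (simp add: lin_ext_def basis_vec_def)

lemma basis_vec_neq_0: "basis_vec i \<noteq> (0 :: 'i \<Rightarrow>\<^sub>0 'k::field)"
  by (metis basis_vec_def lookup_single_eq lookup_zero zero_neq_one)

lemma lin_comp: "lin f \<Longrightarrow> lin g \<Longrightarrow> lin (\<lambda>x. f (g x))"
  using Vector_Spaces.linear_compose[of scale scale g scale f] by (simp add: o_def)

text \<open>Agreement is only asked on the support of \<open>x\<close>: several identities below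
  hold on the basis of a tensor power but not for all lists.\<close>

lemma lin_eqI:
  assumes "lin f" and "lin g" and "\<And>i. i \<in> Poly_Mapping.keys x \<Longrightarrow> f (basis_vec i) = g (basis_vec i)"
  shows "f x = g x"
  unfolding lin_expand[OF assms(1), of x] lin_expand[OF assms(2), of x] lin_ext_def
  by (rule sum.cong) (simp_all add: assms(3))

lemma lin_ext_lin_ext: "lin_ext f (lin_ext g x) = lin_ext (\<lambda>i. lin_ext f (g i)) x"
  by (rule lin_eqI[where f = "\<lambda>x. lin_ext f (lin_ext g x)"])
    (auto intro: lin_comp lin_lin_ext)

lemma lin_ext_basis_vec [simp]: "lin_ext basis_vec x = x"
  by (simp add: lin_ext_def basis_expansion[symmetric])

lemma lin_ext_fun_add: "lin_ext (\<lambda>i. f i + g i) x = lin_ext f x + lin_ext g x"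
  by (simp add: lin_ext_def scale.scale_right_distrib sum.distrib)

lemma lin_ext_fun_scale: "lin_ext (\<lambda>i. scale c (f i)) x = scale c (lin_ext f x)"
  by (simp add: lin_ext_def scale.scale_sum_right mult.commute)

lemma lin_ext_fun_zero [simp]: "lin_ext (\<lambda>i. 0) x = 0"
  by (simp add: lin_ext_def)

lemma lin_ext_fun_diff: "lin_ext (\<lambda>i. f i - g i) x = lin_ext f x - lin_ext g x"
  by (simp add: lin_ext_def scale.scale_right_diff_distrib sum_subtractf)

section \<open>The algebra of endomorphisms\<close>

text \<open>An endomorphism of a free vector space is stored as the family of its values on the basis.\<close>

typedef (overloaded) ('i, 'k) endo = "UNIV :: ('i \<Rightarrow> 'i \<Rightarrow>\<^sub>0 'k::field) set"
  morphisms col Endo ..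

declare Endo_inverse [OF UNIV_I, simp]

lemma endo_eqI: "(\<And>i. col A i = col B i) \<Longrightarrow> A = B"
  by (simp add: col_inject[symmetric] fun_eq_iff)

definition act :: "('i, 'k::field) endo \<Rightarrow> ('i \<Rightarrow>\<^sub>0 'k) \<Rightarrow> 'i \<Rightarrow>\<^sub>0 'k" where
  "act A = lin_ext (col A)"

lemma lin_act: "lin (act A)"
  by (simp add: act_def lin_lin_ext)

lemmas act_simps [simp] = linD[OF lin_act]

lemma act_basis [simp]: "act A (basis_vec i) = col A i"
  by (simp add: act_def)

instantiation endo :: (type, field) ring_1
begin

definition zero_endo :: "('a, 'b) endo" where "0 = Endo (\<lambda>i. 0)"
definition one_endo :: "('a, 'b) endo" where "1 = Endo basis_vec"
definition plus_endo :: "('a, 'b) endo \<Rightarrow> ('a, 'b) endo \<Rightarrow> ('a, 'b) endo" where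
  "A + B = Endo (\<lambda>i. col A i + col B i)"
definition uminus_endo :: "('a, 'b) endo \<Rightarrow> ('a, 'b) endo" where
  "- A = Endo (\<lambda>i. - col A i)"
definition minus_endo :: "('a, 'b) endo \<Rightarrow> ('a, 'b) endo \<Rightarrow> ('a, 'b) endo" where
  "A - B = Endo (\<lambda>i. col A i - col B i)"
definition times_endo :: "('a, 'b) endo \<Rightarrow> ('a, 'b) endo \<Rightarrow> ('a, 'b) endo" where
  "A * B = Endo (\<lambda>i. act A (col B i))"

lemmas endo_defs = zero_endo_def one_endo_def plus_endo_def uminus_endo_def minus_endo_def times_endo_def

instance
proof
  fix A B C :: "('a, 'b) endo"
  show "A * B * C = A * (B * C)"
    by (simp add: endo_defs act_def lin_ext_lin_ext)
  show "(A + B) * C = A * C + B * C"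
    by (simp add: endo_defs act_def lin_ext_fun_add)
  have "col (0 :: ('a, 'b) endo) undefined \<noteq> col 1 undefined"
    by (simp add: endo_defs basis_vec_neq_0)
  then show "(0 :: ('a, 'b) endo) \<noteq> 1"
    by metis
qed (simp_all add: endo_defs act_def linD[OF lin_lin_ext] algebra_simps col_inverse)

end

definition smul :: "'k::field \<Rightarrow> ('i, 'k) endo \<Rightarrow> ('i, 'k) endo" where
  "smul c A = Endo (\<lambda>i. scale c (col A i))"

lemma col_simps [simp]:
  "col 0 i = 0" "col 1 i = basis_vec i" "col (A + B) i = col A i + col B i"
  "col (- A) i = - col A i" "col (A - B) i = col A i - col B i"
  "col (A * B) i = act A (col B i)" "col (smul c A) i = scale c (col A i)"
  by (simp_all add: endo_defs smul_def)

lemma act_endo_simps [simp]: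
  "act 0 x = 0" "act 1 x = x" "act (A + B) x = act A x + act B x" "act (A - B) x = act A x - act B x"
  "act (A * B) x = act A (act B x)" "act (smul c A) x = scale c (act A x)"
  by (simp_all add: act_def endo_defs smul_def lin_ext_fun_add lin_ext_fun_diff
      lin_ext_fun_scale lin_ext_lin_ext)

lemma smul_simps [simp]:
  "smul c A * B = smul c (A * B)" "A * smul c B = smul c (A * B)"
  "smul c (smul d A) = smul (c * d) A" "smul 1 A = A" "smul 0 A = 0" "smul c 0 = 0"
  by (rule endo_eqI, simp)+

lemma smul_distrib:
  "smul c (A + B) = smul c A + smul c B" "smul c (A - B) = smul c A - smul c B"
  "smul (c + d) A = smul c A + smul d A" "smul (c - d) A = smul c A - smul d A"
  by (rule endo_eqI, simp add: scale.scale_right_distrib scale.scale_left_distrib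
      scale.scale_right_diff_distrib scale.scale_left_diff_distrib)+

text \<open>\<open>lin_ext\<close> has values in free vector spaces, which \<open>endo\<close> is
  not; hence linear extension to endomorphisms is done column by column.\<close>

definition lift :: "('m \<Rightarrow> ('i, 'k) endo) \<Rightarrow> ('m \<Rightarrow>\<^sub>0 'k::field) \<Rightarrow> ('i, 'k) endo" where
  "lift h p = Endo (\<lambda>i. lin_ext (\<lambda>w. col (h w) i) p)"

lemma act_lift: "act (lift h p) x = lin_ext (\<lambda>w. act (h w) x) p"
proof -
  have "lin (\<lambda>x. lin_ext (\<lambda>w. act (h w) x) p)"
    by (rule linI) (simp_all add: lin_ext_fun_add lin_ext_fun_scale)
  then show ?thesis
    by (rule lin_eqI[OF lin_act]) (simp add: lift_def)
qed

lemma lift_simps [simp]: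
  "lift h (p + q) = lift h p + lift h q" "lift h (p - q) = lift h p - lift h q"
  "lift h (scale c p) = smul c (lift h p)" "lift h 0 = 0" "lift h (basis_vec w) = h w"
  by (rule endo_eqI, simp add: lift_def)+

section \<open>Compatibility of linear extension with the product of the monoid algebra\<close>

lemma scale_eq_mult: "scale c p = Poly_Mapping.single 0 c * p"
  by (simp add: scale_def mult_map_scale_conv_mult)

lemma lin_mult_right: "lin (\<lambda>p :: 'm::monoid_add \<Rightarrow>\<^sub>0 'k::field. p * q)"
  by (rule linI) (simp_all add: algebra_simps scale_eq_mult)

lemma mult_scale:
  fixes p q :: "'m::monoid_add \<Rightarrow>\<^sub>0 'k::field"
  shows "scale c p * q = scale c (p * q)" and "p * scale c q = scale c (p * q)"
proof -
  have basis: "basis_vec w * Poly_Mapping.single 0 c = scale c (basis_vec w)" for w :: 'm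
    by (simp only: single_eq_scale[symmetric]) (simp add: basis_vec_def mult_single)
  have "p * Poly_Mapping.single 0 c = scale c p"
    by (rule lin_eqI[OF lin_mult_right scale.linear_scale_self]) (rule basis)
  then show "p * scale c q = scale c (p * q)"
    by (simp add: scale_eq_mult mult.assoc[symmetric])
qed (simp add: scale_eq_mult mult.assoc)

lemma lin_mult_left: "lin ((*) (p :: 'm::monoid_add \<Rightarrow>\<^sub>0 'k::field))"
  by (rule linI) (simp_all add: algebra_simps mult_scale)

lemma basis_vec_mult: "basis_vec u * basis_vec w = basis_vec (u + w)"
  by (simp add: basis_vec_def mult_single)

lemma one_eq_basis_vec: "1 = basis_vec 0"
  by (simp add: basis_vec_def)

lemma lift_mult:
  fixes h :: "'m::monoid_add \<Rightarrow> ('i, 'k::field) endo"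
  assumes "\<And>u w. h (u + w) = h u * h w"
  shows "lift h (p * q) = lift h p * lift h q"
proof (rule endo_eqI)
  fix i
  let ?f = "lin_ext (\<lambda>w. col (h w) i)"
  \<comment> \<open>The identity is linear in \<open>p\<close> and in \<open>q\<close>. Here
    \<open>p\<close> is a basis vector and linearity in \<open>q\<close> is used; \<open>2\<close>
    then uses linearity in \<open>p\<close>.\<close>
  have 1: "?f (basis_vec u * q) = act (h u) (?f q)" for u
    by (rule lin_eqI[where f = "\<lambda>q. ?f (basis_vec u * q)" and g = "\<lambda>q. act (h u) (?f q)"])
      (auto intro: lin_comp[OF lin_lin_ext lin_mult_left] lin_comp[OF lin_act lin_lin_ext]
        simp: basis_vec_mult assms)
  have 2: "?f (p * q) = lin_ext (\<lambda>u. act (h u) (?f q)) p"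
    by (rule lin_eqI[where f = "\<lambda>p. ?f (p * q)"])
      (auto intro: lin_comp[OF lin_lin_ext lin_mult_right] lin_lin_ext simp: 1)
  show "col (lift h (p * q)) i = col (lift h p * lift h q) i"
    by (simp add: act_lift 2) (simp add: lift_def 2)
qed

section \<open>Tensor products\<close>

lemma tens_left [simp]:
  "tens h (x + y) z = tens h x z + tens h y z" "tens h (x - y) z = tens h x z - tens h y z"
  "tens h (scale c x) z = scale c (tens h x z)" "tens h 0 z = 0"
  by (simp_all add: tens_def)

lemma tens_right [simp]:
  "tens h z (x + y) = tens h z x + tens h z y" "tens h z (x - y) = tens h z x - tens h z y"
  "tens h z (scale c x) = scale c (tens h z x)" "tens h z 0 = 0"
  by (simp_all add: tens_def lin_ext_fun_add lin_ext_fun_diff lin_ext_fun_scale)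

lemma tens_basis_vec [simp]: "tens h (basis_vec i) (basis_vec j) = basis_vec (h i j)"
  by (simp add: tens_def)

lemma lin_tens: "lin (\<lambda>x. tens h x y)" "lin (\<lambda>y. tens h x y)"
  by (rule linI, simp_all)+

text \<open>The column of the index \<open>[]\<close>, which does not occur in \<open>V \<otimes> W\<close>, is zero, so that
  \<open>tensor_endo\<close> is multiplicative but \<open>tensor_endo 1 1 \<noteq> 1\<close>.\<close>

definition tensor_endo :: "('i, 'k::field) endo \<Rightarrow> ('i list, 'k) endo \<Rightarrow> ('i list, 'k) endo"
    (infixr \<open>\<otimes>\<^sub>e\<close> 75) where
  "A \<otimes>\<^sub>e B = Endo (\<lambda>is. case is of [] \<Rightarrow> 0 | i # js \<Rightarrow> tens (#) (col A i) (col B js))"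

lemma col_tensor_endo [simp]:
  "col (A \<otimes>\<^sub>e B) [] = 0" "col (A \<otimes>\<^sub>e B) (i # js) = tens (#) (col A i) (col B js)"
  by (simp_all add: tensor_endo_def)

lemma act_tensor_endo [simp]: "act (A \<otimes>\<^sub>e B) (tens (#) x y) = tens (#) (act A x) (act B y)"
proof -
  have basis: "act (A \<otimes>\<^sub>e B) (tens (#) (basis_vec i) y) = tens (#) (act A (basis_vec i)) (act B y)" for i
    by (rule lin_eqI[OF lin_comp[OF lin_act lin_tens(2)] lin_comp[OF lin_tens(2) lin_act]]) simp
  show ?thesis
    by (rule lin_eqI[OF lin_comp[OF lin_act lin_tens(1)] lin_comp[OF lin_tens(1) lin_act]])
      (rule basis)
qed

lemma tensor_endo_eqI:
  assumes "col A [] = col B []" and "\<And>i js. col A (i # js) = col B (i # js)"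
  shows "A = B"
proof (rule endo_eqI)
  show "col A is = col B is" for "is"
    by (cases "is") (simp_all add: assms)
qed

lemma tensor_endo_mult [simp]: "(A \<otimes>\<^sub>e B) * (C \<otimes>\<^sub>e D) = (A * C) \<otimes>\<^sub>e (B * D)"
  by (rule tensor_endo_eqI) simp_all

lemma tensor_endo_zero [simp]: "0 \<otimes>\<^sub>e B = 0" "A \<otimes>\<^sub>e 0 = 0"
  by (rule tensor_endo_eqI; simp)+

lemma tensor_endo_smul [simp]:
  "smul c A \<otimes>\<^sub>e B = smul c (A \<otimes>\<^sub>e B)" "A \<otimes>\<^sub>e smul c B = smul c (A \<otimes>\<^sub>e B)"
  by (rule tensor_endo_eqI; simp)+

lemma tensor_endo_distrib_left:
  "(A + B) \<otimes>\<^sub>e C = A \<otimes>\<^sub>e C + B \<otimes>\<^sub>e C" "(A - B) \<otimes>\<^sub>e C = A \<otimes>\<^sub>e C - B \<otimes>\<^sub>e C"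
  by (rule tensor_endo_eqI; simp)+

lemma tensor_endo_distrib_right:
  "C \<otimes>\<^sub>e (A + B) = C \<otimes>\<^sub>e A + C \<otimes>\<^sub>e B" "C \<otimes>\<^sub>e (A - B) = C \<otimes>\<^sub>e A - C \<otimes>\<^sub>e B"
  by (rule tensor_endo_eqI; simp)+

lemmas tensor_endo_distrib = tensor_endo_distrib_left tensor_endo_distrib_right

section \<open>Representations\<close>

text \<open>The generators act in the corner of an idempotent \<open>u\<close>, which replaces the unit in the relations:
  \<open>u\<close> is the projection onto the module, and the index type is usually larger than its basis.\<close>

locale gl_rep =
  fixes n :: nat and r s :: "'k::field" and u :: "('i, 'k) endo" and \<rho> :: "gen \<Rightarrow> ('i, 'k) endo"
  assumes param: "r \<noteq> 0" "s \<noteq> 0" "r \<noteq> s"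
    and idem: "u * u = u"
    and corner: "g \<in> gens n \<Longrightarrow> \<rho> g * u = \<rho> g" "g \<in> gens n \<Longrightarrow> u * \<rho> g = \<rho> g"
    and torus: "\<lbrakk>g \<in> torus_gens n; h \<in> torus_gens n\<rbrakk> \<Longrightarrow> \<rho> g * \<rho> h = \<rho> h * \<rho> g"
    and a_inv: "i \<in> {1..n} \<Longrightarrow> \<rho> (GA i) * \<rho> (GAi i) = u"
    and b_inv: "i \<in> {1..n} \<Longrightarrow> \<rho> (GB i) * \<rho> (GBi i) = u"
    and a_e: "\<lbrakk>i \<in> {1..n}; j \<in> {1..<n}\<rbrakk> \<Longrightarrow>
      \<rho> (GA i) * \<rho> (GE j) = smul (r powi eps_alpha i j) (\<rho> (GE j) * \<rho> (GA i))"
    and a_f: "\<lbrakk>i \<in> {1..n}; j \<in> {1..<n}\<rbrakk> \<Longrightarrow>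
      \<rho> (GA i) * \<rho> (GF j) = smul (r powi (- eps_alpha i j)) (\<rho> (GF j) * \<rho> (GA i))"
    and b_e: "\<lbrakk>i \<in> {1..n}; j \<in> {1..<n}\<rbrakk> \<Longrightarrow>
      \<rho> (GB i) * \<rho> (GE j) = smul (s powi eps_alpha i j) (\<rho> (GE j) * \<rho> (GB i))"
    and b_f: "\<lbrakk>i \<in> {1..n}; j \<in> {1..<n}\<rbrakk> \<Longrightarrow>
      \<rho> (GB i) * \<rho> (GF j) = smul (s powi (- eps_alpha i j)) (\<rho> (GF j) * \<rho> (GB i))"
    and e_f: "\<lbrakk>i \<in> {1..<n}; j \<in> {1..<n}\<rbrakk> \<Longrightarrow>
      \<rho> (GE i) * \<rho> (GF j) - \<rho> (GF j) * \<rho> (GE i) =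
      smul (of_bool (i = j) / (r - s)) (\<rho> (GA i) * \<rho> (GB (i+1)) - \<rho> (GA (i+1)) * \<rho> (GB i))"
    and e_comm: "\<lbrakk>i \<in> {1..<n}; j \<in> {1..<n}; \<bar>int i - int j\<bar> > 1\<rbrakk> \<Longrightarrow>
      \<rho> (GE i) * \<rho> (GE j) = \<rho> (GE j) * \<rho> (GE i)"
    and f_comm: "\<lbrakk>i \<in> {1..<n}; j \<in> {1..<n}; \<bar>int i - int j\<bar> > 1\<rbrakk> \<Longrightarrow>
      \<rho> (GF i) * \<rho> (GF j) = \<rho> (GF j) * \<rho> (GF i)"
    and e_serre1: "\<lbrakk>i \<in> {1..<n}; i + 1 \<in> {1..<n}\<rbrakk> \<Longrightarrow>
      \<rho> (GE i) * \<rho> (GE i) * \<rho> (GE (i+1)) - smul (r + s) (\<rho> (GE i) * \<rho> (GE (i+1)) * \<rho> (GE i))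
        + smul (r * s) (\<rho> (GE (i+1)) * \<rho> (GE i) * \<rho> (GE i)) = 0"
    and e_serre2: "\<lbrakk>i \<in> {1..<n}; i + 1 \<in> {1..<n}\<rbrakk> \<Longrightarrow>
      \<rho> (GE i) * \<rho> (GE (i+1)) * \<rho> (GE (i+1)) - smul (r + s) (\<rho> (GE (i+1)) * \<rho> (GE i) * \<rho> (GE (i+1)))
        + smul (r * s) (\<rho> (GE (i+1)) * \<rho> (GE (i+1)) * \<rho> (GE i)) = 0"
    and f_serre1: "\<lbrakk>i \<in> {1..<n}; i + 1 \<in> {1..<n}\<rbrakk> \<Longrightarrow>
      \<rho> (GF i) * \<rho> (GF i) * \<rho> (GF (i+1))
        - smul (inverse r + inverse s) (\<rho> (GF i) * \<rho> (GF (i+1)) * \<rho> (GF i))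
        + smul (inverse r * inverse s) (\<rho> (GF (i+1)) * \<rho> (GF i) * \<rho> (GF i)) = 0"
    and f_serre2: "\<lbrakk>i \<in> {1..<n}; i + 1 \<in> {1..<n}\<rbrakk> \<Longrightarrow>
      \<rho> (GF i) * \<rho> (GF (i+1)) * \<rho> (GF (i+1))
        - smul (inverse r + inverse s) (\<rho> (GF (i+1)) * \<rho> (GF i) * \<rho> (GF (i+1)))
        + smul (inverse r * inverse s) (\<rho> (GF (i+1)) * \<rho> (GF (i+1)) * \<rho> (GF i)) = 0"

subsection \<open>The tensor product of two representations\<close>

fun tensor_rep :: "('i, 'k::field) endo \<Rightarrow> ('i list, 'k) endo \<Rightarrow> (gen \<Rightarrow> ('i, 'k) endo) \<Rightarrow>
    (gen \<Rightarrow> ('i list, 'k) endo) \<Rightarrow> gen \<Rightarrow> ('i list, 'k) endo" where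
  "tensor_rep u v \<rho> \<sigma> (GE i) = \<rho> (GE i) \<otimes>\<^sub>e v + (\<rho> (GA i) * \<rho> (GB (i+1))) \<otimes>\<^sub>e \<sigma> (GE i)"
| "tensor_rep u v \<rho> \<sigma> (GF i) = u \<otimes>\<^sub>e \<sigma> (GF i) + \<rho> (GF i) \<otimes>\<^sub>e (\<sigma> (GA (i+1)) * \<sigma> (GB i))"
| "tensor_rep u v \<rho> \<sigma> g = \<rho> g \<otimes>\<^sub>e \<sigma> g"

lemma smul_cancel: "smul c X = 0 \<Longrightarrow> c \<noteq> 0 \<Longrightarrow> X = 0"
  by (metis smul_simps(3,4,6) left_inverse)

text \<open>Sorted by the factors that occur, the expansion splits into six groups. Two of them are the
  Serre relations of \<open>x, x'\<close> and \<open>y, y'\<close>; in each of the others the commutation scalars cancel.\<close>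

lemma serre_sum:
  fixes x y x' y' :: "('i, 'k::field) endo"
  assumes x: "x * x * x' - smul A (x * x' * x) + smul B (x' * x * x) = 0"
    and y: "y * y * y' - smul A (y * y' * y) + smul B (y' * y * y) = 0"
    and comm: "y * x = smul q (x * y)" "y * x' = smul \<alpha> (x' * y)"
      "y' * x = smul \<beta> (x * y')"
    and coeffs: "1 - A * \<beta> + B * \<beta>\<^sup>2 = 0" "\<alpha>\<^sup>2 - A * \<alpha> + B = 0" "(1 + q) * \<alpha> = A"
      "A * q * \<alpha> = B * (1 + q)" "1 + q = A * \<beta> * q" "A = B * \<beta> * (1 + q)"
  shows "(x + y) * (x + y) * (x' + y') - smul A ((x + y) * (x' + y') * (x + y))
    + smul B ((x' + y') * (x + y) * (x + y)) = 0"
proof -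
  have comm': "y * (x * z) = smul q (x * (y * z))" "y * (x' * z) = smul \<alpha> (x' * (y * z))"
    "y' * (x * z) = smul \<beta> (x * (y' * z))" for z
    using comm by (simp_all add: mult.assoc[symmetric])
  have zero: "(1 + q) * \<alpha> - A = 0" "B * (1 + q) - A * q * \<alpha> = 0" "1 + q - A * \<beta> * q = 0"
    "B * \<beta> * (1 + q) - A = 0"
    unfolding right_minus_eq by (rule coeffs coeffs[symmetric])+
  have "x * x * y' - smul A (x * y' * x) + smul B (y' * x * x)
      = smul (1 - A * \<beta> + B * \<beta>\<^sup>2) (x * x * y')"
    by (simp add: comm comm' mult.assoc power2_eq_square) (simp add: smul_distrib)
  then have 1: "x * x * y' - smul A (x * y' * x) + smul B (y' * x * x) = 0"
    by (simp add: coeffs(1))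
  have "y * y * x' - smul A (y * x' * y) + smul B (x' * y * y)
      = smul (\<alpha>\<^sup>2 - A * \<alpha> + B) (x' * y * y)"
    by (simp add: comm comm' mult.assoc power2_eq_square) (simp add: smul_distrib)
  then have 2: "y * y * x' - smul A (y * x' * y) + smul B (x' * y * y) = 0"
    by (simp add: coeffs(2))
  have "x * y * x' + y * x * x' - smul A (x * x' * y + y * x' * x) + smul B (x' * x * y + x' * y * x)
      = smul ((1 + q) * \<alpha> - A) (x * x' * y) + smul (B * (1 + q) - A * q * \<alpha>) (x' * x * y)"
    by (simp add: comm comm' mult.assoc smul_distrib distrib_left distrib_right)
      (simp add: algebra_simps)
  then have 3: "x * y * x' + y * x * x' - smul A (x * x' * y + y * x' * x)
      + smul B (x' * x * y + x' * y * x) = 0"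
    by (simp only: zero) simp
  have "x * y * y' + y * x * y' - smul A (x * y' * y + y * y' * x) + smul B (y' * x * y + y' * y * x)
      = smul (1 + q - A * \<beta> * q) (x * y * y') + smul (B * \<beta> * (1 + q) - A) (x * y' * y)"
    by (simp add: comm comm' mult.assoc smul_distrib distrib_left distrib_right)
      (simp add: algebra_simps)
  then have 4: "x * y * y' + y * x * y' - smul A (x * y' * y + y * y' * x)
      + smul B (y' * x * y + y' * y * x) = 0"
    by (simp only: zero) simp
  have "(x + y) * (x + y) * (x' + y') - smul A ((x + y) * (x' + y') * (x + y))
      + smul B ((x' + y') * (x + y) * (x + y))
    = (x * x * x' - smul A (x * x' * x) + smul B (x' * x * x))
      + (y * y * y' - smul A (y * y' * y) + smul B (y' * y * y))
      + (x * x * y' - smul A (x * y' * x) + smul B (y' * x * x))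
      + (y * y * x' - smul A (y * x' * y) + smul B (x' * y * y))
      + (x * y * x' + y * x * x' - smul A (x * x' * y + y * x' * x) + smul B (x' * x * y + x' * y * x))
      + (x * y * y' + y * x * y' - smul A (x * y' * y + y * y' * x) + smul B (y' * x * y + y' * y * x))"
    by (simp only: smul_distrib distrib_left distrib_right) (simp add: algebra_simps)
  also have "\<dots> = 0"
    by (simp only: x y 1 2 3 4) simp
  finally show ?thesis .
qed

lemma gens_iff [simp]:
  "GE j \<in> gens n \<longleftrightarrow> j \<in> {1..<n}" "GF j \<in> gens n \<longleftrightarrow> j \<in> {1..<n}"
  "GA j \<in> gens n \<longleftrightarrow> j \<in> {1..n}" "GAi j \<in> gens n \<longleftrightarrow> j \<in> {1..n}"
  "GB j \<in> gens n \<longleftrightarrow> j \<in> {1..n}" "GBi j \<in> gens n \<longleftrightarrow> j \<in> {1..n}"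
  by (auto simp: gens_def)

lemma torus_gens_iff [simp]:
  "GE j \<notin> torus_gens n" "GF j \<notin> torus_gens n"
  "GA j \<in> torus_gens n \<longleftrightarrow> j \<in> {1..n}" "GAi j \<in> torus_gens n \<longleftrightarrow> j \<in> {1..n}"
  "GB j \<in> torus_gens n \<longleftrightarrow> j \<in> {1..n}" "GBi j \<in> torus_gens n \<longleftrightarrow> j \<in> {1..n}"
  by (auto simp: torus_gens_def)

lemma torus_gens_subset: "torus_gens n \<subseteq> gens n"
  by (auto simp: gens_def torus_gens_def)

context gl_rep
begin

definition \<Omega> where "\<Omega> j = \<rho> (GA j) * \<rho> (GB (j+1))"
definition \<Omega>' where "\<Omega>' j = \<rho> (GA (j+1)) * \<rho> (GB j)"

text \<open>The indices of the two torus factors are kept independent, so that one statement covers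
  both \<open>\<Omega>\<close> and \<open>\<Omega>'\<close>.\<close>

lemma move_e:
  assumes "i \<in> {1..n}" "l \<in> {1..n}" "j \<in> {1..<n}"
  shows "\<rho> (GA i) * \<rho> (GB l) * \<rho> (GE j)
    = smul (r powi eps_alpha i j * s powi eps_alpha l j) (\<rho> (GE j) * (\<rho> (GA i) * \<rho> (GB l)))"
  using a_e[of i j] b_e[of l j] assms by (simp add: mult.assoc) (simp add: mult.assoc[symmetric] mult.commute)

lemma move_f:
  assumes "i \<in> {1..n}" "l \<in> {1..n}" "j \<in> {1..<n}"
  shows "\<rho> (GA i) * \<rho> (GB l) * \<rho> (GF j)
    = smul (r powi - eps_alpha i j * s powi - eps_alpha l j) (\<rho> (GF j) * (\<rho> (GA i) * \<rho> (GB l)))"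
  using a_f[of i j] b_f[of l j] assms by (simp add: mult.assoc) (simp add: mult.assoc[symmetric] mult.commute)

lemma \<Omega>_e: "\<lbrakk>i \<in> {1..<n}; j \<in> {1..<n}\<rbrakk> \<Longrightarrow>
    \<Omega> i * \<rho> (GE j) = smul (r powi eps_alpha i j * s powi eps_alpha (i+1) j) (\<rho> (GE j) * \<Omega> i)"
  and \<Omega>_f: "\<lbrakk>i \<in> {1..<n}; j \<in> {1..<n}\<rbrakk> \<Longrightarrow>
    \<Omega> i * \<rho> (GF j) = smul (r powi - eps_alpha i j * s powi - eps_alpha (i+1) j) (\<rho> (GF j) * \<Omega> i)"
  and \<Omega>'_e: "\<lbrakk>i \<in> {1..<n}; j \<in> {1..<n}\<rbrakk> \<Longrightarrow>
    \<Omega>' i * \<rho> (GE j) = smul (r powi eps_alpha (i+1) j * s powi eps_alpha i j) (\<rho> (GE j) * \<Omega>' i)"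
  and \<Omega>'_f: "\<lbrakk>i \<in> {1..<n}; j \<in> {1..<n}\<rbrakk> \<Longrightarrow>
    \<Omega>' i * \<rho> (GF j) = smul (r powi - eps_alpha (i+1) j * s powi - eps_alpha i j) (\<rho> (GF j) * \<Omega>' i)"
  unfolding \<Omega>_def \<Omega>'_def by (rule move_e move_f; simp)+

lemma torus_left_comm:
  "\<lbrakk>g \<in> torus_gens n; h \<in> torus_gens n\<rbrakk> \<Longrightarrow> \<rho> g * (\<rho> h * X) = \<rho> h * (\<rho> g * X)"
  by (simp add: torus mult.assoc[symmetric])

lemma \<Omega>_comm: "\<lbrakk>i \<in> {1..<n}; j \<in> {1..<n}\<rbrakk> \<Longrightarrow> \<Omega> i * \<Omega> j = \<Omega> j * \<Omega> i"
  and \<Omega>'_comm: "\<lbrakk>i \<in> {1..<n}; j \<in> {1..<n}\<rbrakk> \<Longrightarrow> \<Omega>' i * \<Omega>' j = \<Omega>' j * \<Omega>' i"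
  unfolding \<Omega>_def \<Omega>'_def
  by (simp_all add: mult.assoc torus torus_left_comm)

lemma \<Omega>_corner: "i \<in> {1..<n} \<Longrightarrow> \<Omega> i * u = \<Omega> i" "i \<in> {1..<n} \<Longrightarrow> u * \<Omega> i = \<Omega> i"
  "i \<in> {1..<n} \<Longrightarrow> \<Omega>' i * u = \<Omega>' i" "i \<in> {1..<n} \<Longrightarrow> u * \<Omega>' i = \<Omega>' i"
  unfolding \<Omega>_def \<Omega>'_def by (simp_all add: mult.assoc corner) (simp_all add: mult.assoc[symmetric] corner)

end

text \<open>Up to the factor \<open>B\<close>, the second Serre relation is one of the first shape
  with the two generators exchanged. This lets \<open>serre_sum\<close> treat both shapes.\<close>

lemma serre_flip:
  fixes x y :: "('i, 'k::field) endo"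
  assumes "B \<noteq> 0"
  shows "x * y * y - smul A (y * x * y) + smul B (y * y * x) = 0 \<longleftrightarrow>
    y * y * x - smul (A / B) (y * x * y) + smul (1 / B) (x * y * y) = 0"
proof -
  have "x * y * y - smul A (y * x * y) + smul B (y * y * x)
      = smul B (y * y * x - smul (A / B) (y * x * y) + smul (1 / B) (x * y * y))"
    using assms by (simp add: smul_distrib)
  then show ?thesis
    using assms smul_cancel by fastforce
qed

text \<open>As \<open>z\<close> and \<open>w\<close> commute, all three monomials have the same
  second factor \<open>z * (z * w)\<close>, and the relation between \<open>x\<close> and
  \<open>y\<close> factors out.\<close>

lemma serre_tensor_left:
  assumes "x * x * y - smul A (x * y * x) + smul B (y * x * x) = 0" and comm: "w * z = z * w"
  shows "(x \<otimes>\<^sub>e z) * (x \<otimes>\<^sub>e z) * (y \<otimes>\<^sub>e w) - smul A ((x \<otimes>\<^sub>e z) * (y \<otimes>\<^sub>e w) * (x \<otimes>\<^sub>e z))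
    + smul B ((y \<otimes>\<^sub>e w) * (x \<otimes>\<^sub>e z) * (x \<otimes>\<^sub>e z)) = 0"
proof -
  have "w * (z * z) = z * (z * w)" "z * (w * z) = z * (z * w)"
    by (metis comm mult.assoc)+
  then have "?thesis \<longleftrightarrow> (x * x * y - smul A (x * y * x) + smul B (y * x * x)) \<otimes>\<^sub>e (z * (z * w)) = 0"
    by (simp add: tensor_endo_distrib mult.assoc)
  then show ?thesis
    by (simp add: assms)
qed

lemma serre_tensor_right:
  assumes "x * x * y - smul A (x * y * x) + smul B (y * x * x) = 0" and comm: "w * z = z * w"
  shows "(z \<otimes>\<^sub>e x) * (z \<otimes>\<^sub>e x) * (w \<otimes>\<^sub>e y) - smul A ((z \<otimes>\<^sub>e x) * (w \<otimes>\<^sub>e y) * (z \<otimes>\<^sub>e x))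
    + smul B ((w \<otimes>\<^sub>e y) * (z \<otimes>\<^sub>e x) * (z \<otimes>\<^sub>e x)) = 0"
proof -
  have "w * (z * z) = z * (z * w)" "z * (w * z) = z * (z * w)"
    by (metis comm mult.assoc)+
  then have "?thesis \<longleftrightarrow> (z * (z * w)) \<otimes>\<^sub>e (x * x * y - smul A (x * y * x) + smul B (y * x * x)) = 0"
    by (simp add: tensor_endo_distrib mult.assoc)
  then show ?thesis
    by (simp add: assms)
qed

lemma gl_rep_tensor:
  assumes "gl_rep n r s u \<rho>" and "gl_rep n r s v \<sigma>"
  shows "gl_rep n r s (u \<otimes>\<^sub>e v) (tensor_rep u v \<rho> \<sigma>)"
proof -
  interpret P: gl_rep n r s u \<rho> by fact
  interpret Q: gl_rep n r s v \<sigma> by fact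
  let ?T = "tensor_rep u v \<rho> \<sigma>"
  \<comment> \<open>The two summands of the coproduct of each e and of each f; all relations below
    reduce to how these commute with each other.\<close>
  let ?x = "\<lambda>i. \<rho> (GE i) \<otimes>\<^sub>e v" and ?y = "\<lambda>i. P.\<Omega> i \<otimes>\<^sub>e \<sigma> (GE i)"
  let ?x' = "\<lambda>i. u \<otimes>\<^sub>e \<sigma> (GF i)" and ?y' = "\<lambda>i. \<rho> (GF i) \<otimes>\<^sub>e Q.\<Omega>' i"
  have T_e: "?T (GE i) = ?x i + ?y i" and T_f: "?T (GF i) = ?x' i + ?y' i" for i
    by (simp_all add: P.\<Omega>_def Q.\<Omega>'_def)
  have T_torus: "?T g = \<rho> g \<otimes>\<^sub>e \<sigma> g" if "g \<in> torus_gens n" for g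
    using that by (cases g) simp_all
  note corner = P.corner Q.corner P.\<Omega>_corner Q.\<Omega>_corner P.idem Q.idem
  \<comment> \<open>For e the scalar arises in the first tensor factor, where
    \<open>\<Omega> i\<close> passes \<open>\<rho> (GE j)\<close>; for f it arises in the second,
    where \<open>\<Omega>' i\<close> passes \<open>\<sigma> (GF j)\<close>.\<close>
  have yx: "?y i * ?x j = smul (r powi eps_alpha i j * s powi eps_alpha (i+1) j) (?x j * ?y i)"
    and yx': "?y' i * ?x' j = smul (r powi - eps_alpha (i+1) j * s powi - eps_alpha i j) (?x' j * ?y' i)"
    if "i \<in> {1..<n}" "j \<in> {1..<n}" for i j
    using that P.\<Omega>_e[OF that] Q.\<Omega>'_f[OF that] by (simp_all add: corner)
  have torus_\<Omega>: "\<rho> g * P.\<Omega> j = P.\<Omega> j * \<rho> g" "\<sigma> g * Q.\<Omega>' j = Q.\<Omega>' j * \<sigma> g"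
    if "g \<in> torus_gens n" "j \<in> {1..<n}" for g j
    using that by (simp_all add: P.\<Omega>_def Q.\<Omega>'_def mult.assoc P.torus P.torus_left_comm Q.torus Q.torus_left_comm)
  have nz: "r * s \<noteq> 0" "inverse r * inverse s \<noteq> 0"
    using P.param by auto
  show ?thesis
  proof
    fix g assume g: "g \<in> gens n"
    show "?T g * (u \<otimes>\<^sub>e v) = ?T g" "(u \<otimes>\<^sub>e v) * ?T g = ?T g"
      using g by (cases g; simp add: T_e T_f corner distrib_left distrib_right del: tensor_rep.simps(1,2))+
  next
    fix g h assume "g \<in> torus_gens n" "h \<in> torus_gens n"
    then show "?T g * ?T h = ?T h * ?T g"
      by (simp add: T_torus P.torus[of g h] Q.torus[of g h])
  next
    fix i j assume i: "i \<in> {1..n}" and j: "j \<in> {1..<n}"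
    note simps = T_e T_f distrib_left distrib_right corner torus_\<Omega> smul_distrib
      P.a_e P.a_f P.b_e P.b_f Q.a_e Q.a_f Q.b_e Q.b_f
    show "?T (GA i) * ?T (GE j) = smul (r powi eps_alpha i j) (?T (GE j) * ?T (GA i))"
      "?T (GA i) * ?T (GF j) = smul (r powi - eps_alpha i j) (?T (GF j) * ?T (GA i))"
      "?T (GB i) * ?T (GE j) = smul (s powi eps_alpha i j) (?T (GE j) * ?T (GB i))"
      "?T (GB i) * ?T (GF j) = smul (s powi - eps_alpha i j) (?T (GF j) * ?T (GB i))"
      using i j by (simp_all add: simps del: tensor_rep.simps(1,2))
  next
    fix i j assume i: "i \<in> {1..<n}" and j: "j \<in> {1..<n}"
    let ?k = "of_bool (i = j) / (r - s)"
    have eps: "eps_alpha (Suc j) i = - eps_alpha i j" "eps_alpha j i = - eps_alpha (Suc i) j"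
      by (auto simp: eps_alpha_def)
    \<comment> \<open>This is the one mixed term of the commutator that does not cancel at once. By
      \<open>eps\<close> the scalars from the two tensor factors agree: both sides are the same
      multiple of \<open>(\<rho> (GF j) * P.\<Omega> i) \<otimes>\<^sub>e (\<sigma> (GE i) *
      Q.\<Omega>' j)\<close>.\<close>
    have swap: "(P.\<Omega> i * \<rho> (GF j)) \<otimes>\<^sub>e (\<sigma> (GE i) * Q.\<Omega>' j) = (\<rho> (GF j) * P.\<Omega> i) \<otimes>\<^sub>e (Q.\<Omega>' j * \<sigma> (GE i))"
      using P.\<Omega>_f[OF i j] Q.\<Omega>'_e[OF j i] by (simp add: eps)
    have "?T (GE i) * ?T (GF j) - ?T (GF j) * ?T (GE i)
      = (\<rho> (GE i) * \<rho> (GF j) - \<rho> (GF j) * \<rho> (GE i)) \<otimes>\<^sub>e Q.\<Omega>' j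
        + P.\<Omega> i \<otimes>\<^sub>e (\<sigma> (GE i) * \<sigma> (GF j) - \<sigma> (GF j) * \<sigma> (GE i))"
      using i j
      by (simp add: T_e T_f distrib_left distrib_right corner tensor_endo_distrib swap
          del: tensor_rep.simps)
    also have "\<dots> = smul ?k ((P.\<Omega> i - P.\<Omega>' i) \<otimes>\<^sub>e Q.\<Omega>' j + P.\<Omega> i \<otimes>\<^sub>e (Q.\<Omega> i - Q.\<Omega>' i))"
      by (simp add: P.e_f[OF i j] Q.e_f[OF i j] P.\<Omega>_def P.\<Omega>'_def Q.\<Omega>_def Q.\<Omega>'_def smul_distrib
          tensor_endo_distrib)
    \<comment> \<open>For \<open>i = j\<close> the sum telescopes, the two terms
      \<open>P.\<Omega> i \<otimes>\<^sub>e Q.\<Omega>' i\<close> cancelling; otherwise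
      \<open>?k\<close> is zero.\<close>
    also have "\<dots> = smul ?k (P.\<Omega> i \<otimes>\<^sub>e Q.\<Omega> i - P.\<Omega>' i \<otimes>\<^sub>e Q.\<Omega>' i)"
      by (cases "i = j") (simp_all add: tensor_endo_distrib smul_distrib)
    finally show "?T (GE i) * ?T (GF j) - ?T (GF j) * ?T (GE i)
      = smul ?k (?T (GA i) * ?T (GB (i+1)) - ?T (GA (i+1)) * ?T (GB i))"
      by (simp add: P.\<Omega>_def P.\<Omega>'_def Q.\<Omega>_def Q.\<Omega>'_def)
  next
    fix i j assume i: "i \<in> {1..<n}" and j: "j \<in> {1..<n}" and ij: "\<bar>int i - int j\<bar> > 1"
    \<comment> \<open>Distant indices pair to zero, so every commutation scalar of the mixed terms
      is 1.\<close>
    have eps: "eps_alpha i j = 0" "eps_alpha (Suc i) j = 0" "eps_alpha j i = 0" "eps_alpha (Suc j) i = 0"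
      using ij by (auto simp: eps_alpha_def)
    show "?T (GE i) * ?T (GE j) = ?T (GE j) * ?T (GE i)"
      using yx[OF i j] yx[OF j i] P.\<Omega>_comm[OF i j] P.e_comm[OF i j ij] Q.e_comm[OF i j ij]
      by (simp add: T_e distrib_left distrib_right eps del: tensor_rep.simps)
    show "?T (GF i) * ?T (GF j) = ?T (GF j) * ?T (GF i)"
      using yx'[OF i j] yx'[OF j i] Q.\<Omega>'_comm[OF i j] P.f_comm[OF i j ij] Q.f_comm[OF i j ij]
      by (simp add: T_f distrib_left distrib_right eps del: tensor_rep.simps)
  next
    fix i assume i: "i \<in> {1..<n}" and j: "i + 1 \<in> {1..<n}"
    have eps: "\<And>i. eps_alpha i i = 1" "\<And>i. eps_alpha (Suc i) i = -1" "eps_alpha i (Suc i) = 0"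
      "eps_alpha (Suc (Suc i)) i = 0"
      by (auto simp: eps_alpha_def)
    note coeffs = P.param eps power_int_minus field_simps power2_eq_square
    \<comment> \<open>For the first relation of e and the flipped second one of f,
      \<open>serre_sum\<close> is applied with \<open>q\<close>, \<open>\<alpha>\<close>,
      \<open>\<beta>\<close> equal to r/s, s, 1/r and with A = r + s, B = rs. For the other two
      relations, \<open>\<alpha>\<close> and \<open>\<beta>\<close> are exchanged, A = (r + s)/(rs)
      and B = 1/(rs).\<close>
    have e: "?y i * ?x i = smul (r / s) (?x i * ?y i)"
      "?y i * ?x (i+1) = smul s (?x (i+1) * ?y i)"
      "?y (i+1) * ?x i = smul (inverse r) (?x i * ?y (i+1))"
      "?y (i+1) * ?x (i+1) = smul (r / s) (?x (i+1) * ?y (i+1))"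
      using yx[OF i i] yx[OF i j] yx[OF j i] yx[OF j j]
      by (simp_all add: coeffs)
    have f: "?y' i * ?x' i = smul (r / s) (?x' i * ?y' i)"
      "?y' i * ?x' (i+1) = smul (inverse r) (?x' (i+1) * ?y' i)"
      "?y' (i+1) * ?x' i = smul s (?x' i * ?y' (i+1))"
      "?y' (i+1) * ?x' (i+1) = smul (r / s) (?x' (i+1) * ?y' (i+1))"
      using yx'[OF i i] yx'[OF i j] yx'[OF j i] yx'[OF j j]
      by (simp_all add: coeffs)
    note \<Omega>_comm = P.\<Omega>_comm[OF j i] P.\<Omega>_comm[OF i j] Q.\<Omega>'_comm[OF j i] Q.\<Omega>'_comm[OF i j]
    show "?T (GE i) * ?T (GE i) * ?T (GE (i+1)) - smul (r + s) (?T (GE i) * ?T (GE (i+1)) * ?T (GE i))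
        + smul (r * s) (?T (GE (i+1)) * ?T (GE i) * ?T (GE i)) = 0"
      unfolding T_e
      by (rule serre_sum[OF serre_tensor_left[OF P.e_serre1[OF i j] refl]
            serre_tensor_right[OF Q.e_serre1[OF i j] \<Omega>_comm(1)] e(1,2,3)])
        (use P.param in \<open>simp_all add: field_simps power2_eq_square\<close>)
    show "?T (GE i) * ?T (GE (i+1)) * ?T (GE (i+1)) - smul (r + s) (?T (GE (i+1)) * ?T (GE i) * ?T (GE (i+1)))
        + smul (r * s) (?T (GE (i+1)) * ?T (GE (i+1)) * ?T (GE i)) = 0"
      unfolding T_e serre_flip[OF nz(1)]
      by (rule serre_sum[OF serre_tensor_left[OF P.e_serre2[OF i j, unfolded serre_flip[OF nz(1)]] refl]
            serre_tensor_right[OF Q.e_serre2[OF i j, unfolded serre_flip[OF nz(1)]] \<Omega>_comm(2)] e(4,3,2)])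
        (use P.param in \<open>simp_all add: field_simps power2_eq_square\<close>)
    show "?T (GF i) * ?T (GF i) * ?T (GF (i+1))
        - smul (inverse r + inverse s) (?T (GF i) * ?T (GF (i+1)) * ?T (GF i))
        + smul (inverse r * inverse s) (?T (GF (i+1)) * ?T (GF i) * ?T (GF i)) = 0"
      unfolding T_f
      by (rule serre_sum[OF serre_tensor_right[OF Q.f_serre1[OF i j] refl]
            serre_tensor_left[OF P.f_serre1[OF i j] \<Omega>_comm(3)] f(1,2,3)])
        (use P.param in \<open>simp_all add: field_simps power2_eq_square\<close>)
    show "?T (GF i) * ?T (GF (i+1)) * ?T (GF (i+1))
        - smul (inverse r + inverse s) (?T (GF (i+1)) * ?T (GF i) * ?T (GF (i+1)))
        + smul (inverse r * inverse s) (?T (GF (i+1)) * ?T (GF (i+1)) * ?T (GF i)) = 0"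
      unfolding T_f serre_flip[OF nz(2)]
      by (rule serre_sum[OF serre_tensor_right[OF Q.f_serre2[OF i j, unfolded serre_flip[OF nz(2)]] refl]
            serre_tensor_left[OF P.f_serre2[OF i j, unfolded serre_flip[OF nz(2)]] \<Omega>_comm(4)] f(4,3,2)])
        (use P.param in \<open>simp_all add: field_simps power2_eq_square\<close>)
  qed (use P.param in \<open>simp_all add: corner P.a_inv P.b_inv Q.a_inv Q.b_inv\<close>)
qed

section \<open>The natural representation and its tensor powers\<close>

definition projection :: "'i set \<Rightarrow> ('i, 'k::field) endo" where
  "projection B = Endo (\<lambda>i. if i \<in> B then basis_vec i else 0)"

definition nat_rep :: "nat \<Rightarrow> 'k::field \<Rightarrow> 'k \<Rightarrow> gen \<Rightarrow> (nat, 'k) endo" where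
  "nat_rep n r s g = Endo (\<lambda>l. nat_gen n r s g (basis_vec l))"

lemma col_projection [simp]: "col (projection B) i = (if i \<in> B then basis_vec i else 0)"
  by (simp add: projection_def)

lemma projection_idem [simp]: "projection B * projection B = projection B"
  by (rule endo_eqI) simp

lemma munit_basis_vec: "munit i j (basis_vec l) = (if j = l then basis_vec i else 0)"
  by (simp add: munit_def)

lemma lin_munit: "lin (munit i j)"
  by (simp add: munit_def lin_lin_ext)

lemma diag_op_basis_vec:
  "diag_op n c i (basis_vec l) =
    (if l = i then scale c (basis_vec i) else if l \<in> {1..n} then basis_vec l else 0)"
  by (auto simp: diag_op_def munit_basis_vec)

lemma lin_diag_op: "lin (diag_op n c i)"
  by (rule linI)
    (simp_all add: diag_op_def linD[OF lin_munit] scale.scale_right_distrib sum.distrib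
      scale.scale_sum_right mult.commute)

lemma lin_nat_gen: "lin (nat_gen n r s g)"
  by (cases g) (simp_all add: lin_munit lin_diag_op)

lemma act_nat_rep: "act (nat_rep n r s g) x = nat_gen n r s g x"
  by (rule lin_eqI[OF lin_act lin_nat_gen]) (simp add: nat_rep_def)

lemma col_nat_rep:
  "col (nat_rep n r s (GE j)) l = (if l = Suc j then basis_vec j else 0)"
  "col (nat_rep n r s (GF j)) l = (if l = j then basis_vec (Suc j) else 0)"
  "col (nat_rep n r s (GA i)) l =
    (if l = i then scale r (basis_vec i) else if l \<in> {1..n} then basis_vec l else 0)"
  "col (nat_rep n r s (GAi i)) l =
    (if l = i then scale (inverse r) (basis_vec i) else if l \<in> {1..n} then basis_vec l else 0)"
  "col (nat_rep n r s (GB i)) l =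
    (if l = i then scale s (basis_vec i) else if l \<in> {1..n} then basis_vec l else 0)"
  "col (nat_rep n r s (GBi i)) l =
    (if l = i then scale (inverse s) (basis_vec i) else if l \<in> {1..n} then basis_vec l else 0)"
  by (auto simp: nat_rep_def munit_basis_vec diag_op_basis_vec)

lemma scale_basis_cancel:
  "scale a x + scale b x = scale (a + b) x" "scale a x - scale b x = scale (a - b) x"
  by (simp_all add: scale.scale_left_distrib scale.scale_left_diff_distrib)

lemma gl_rep_nat:
  fixes r s :: "'k::field"
  assumes "r \<noteq> 0" "s \<noteq> 0" "r \<noteq> s"
  shows "gl_rep n r s (projection {1..n}) (nat_rep n r s)"
proof
  let ?P = "projection {1..n} :: (nat, 'k) endo" and ?N = "nat_rep n r s"
  show "r \<noteq> 0" "s \<noteq> 0" "r \<noteq> s" by fact+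
  show "?P * ?P = ?P"
    by simp
  fix g assume "g \<in> gens n"
  then show "?N g * ?P = ?N g" "?P * ?N g = ?N g"
    by (cases g; auto intro!: endo_eqI simp: col_nat_rep)+
next
  let ?N = "nat_rep n r s"
  \<comment> \<open>Torus generators act diagonally and therefore commute; the eigenvalue 0 accounts
    for indices outside the module.\<close>
  have *: "col (?N g) l \<in> range (\<lambda>c. scale c (basis_vec l))" if "g \<in> torus_gens n" for g l
    using that
    by (cases g) (auto simp: col_nat_rep intro: range_eqI[of _ _ 1] range_eqI[of _ _ 0])
  fix g h assume "g \<in> torus_gens n" "h \<in> torus_gens n"
  show "?N g * ?N h = ?N h * ?N g"
  proof (rule endo_eqI)
    fix l
    obtain c d where "col (?N g) l = scale c (basis_vec l)" "col (?N h) l = scale d (basis_vec l)"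
      using *[OF \<open>g \<in> _\<close>] *[OF \<open>h \<in> _\<close>] by blast
    then show "col (?N g * ?N h) l = col (?N h * ?N g) l"
      by (simp add: mult.commute)
  qed
next
  fix i j assume "i \<in> {1..<n}" "j \<in> {1..<n}"
  let ?N = "nat_rep n r s"
  show "?N (GE i) * ?N (GF j) - ?N (GF j) * ?N (GE i) =
      smul (of_bool (i = j) / (r - s)) (?N (GA i) * ?N (GB (i+1)) - ?N (GA (i+1)) * ?N (GB i))"
  proof (rule endo_eqI)
    fix l
    \<comment> \<open>The difference of torus products has eigenvalue r - s at the index i and s - r
      at i + 1, and vanishes elsewhere.\<close>
    have "(r - s) / (r - s) = 1" "(s - r) / (r - s) = -1"
      using \<open>r \<noteq> s\<close> by (simp_all add: divide_simps)
    then show "col (?N (GE i) * ?N (GF j) - ?N (GF j) * ?N (GE i)) l =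
      col (smul (of_bool (i = j) / (r - s)) (?N (GA i) * ?N (GB (i+1)) - ?N (GA (i+1)) * ?N (GB i))) l"
      using \<open>i \<in> _\<close> \<open>j \<in> _\<close> \<open>r \<noteq> s\<close>
      by (auto simp: col_nat_rep scale.scale_right_diff_distrib scale_basis_cancel diff_divide_distrib[symmetric])
  qed
next
  fix i j
  assume "i \<in> {1..<n}" "j \<in> {1..<n}" "\<bar>int i - int j\<bar> > 1"
  then show "nat_rep n r s (GE i) * nat_rep n r s (GE j) = nat_rep n r s (GE j) * nat_rep n r s (GE i)"
    "nat_rep n r s (GF i) * nat_rep n r s (GF j) = nat_rep n r s (GF j) * nat_rep n r s (GF i)"
    by (auto intro!: endo_eqI simp: col_nat_rep)
qed (use assms in \<open>auto intro!: endo_eqI simp: col_nat_rep eps_alpha_def power_int_minus\<close>)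

definition triv_rep :: "gen \<Rightarrow> ('i list, 'k::field) endo" where
  "triv_rep g = smul (counit_gen g) (projection {[]})"

lemma gl_rep_triv:
  fixes r s :: "'k::field"
  assumes "r \<noteq> 0" "s \<noteq> 0" "r \<noteq> s"
  shows "gl_rep n r s (projection {[]}) triv_rep"
  using assms
  by unfold_locales (simp_all add: triv_rep_def mult.commute)

section \<open>From the generators to the free algebra\<close>

lemma keys_basis_vec [simp]: "Poly_Mapping.keys (basis_vec i :: 'i \<Rightarrow>\<^sub>0 'k::field) = {i}"
  by (simp add: basis_vec_def)

lemma lift_cong: "(\<And>w. w \<in> Poly_Mapping.keys p \<Longrightarrow> h w = h' w) \<Longrightarrow> lift h p = lift h' p"
  by (simp add: lift_def lin_ext_def)

lemma lift_lin_ext: "lift h (lin_ext f p) = lift (\<lambda>w. lift h (f w)) p"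
  by (rule endo_eqI) (simp add: lift_def lin_ext_lin_ext)

lemma mult_lift: "A * lift h p = lift (\<lambda>w. A * h w) p" "lift h p * A = lift (\<lambda>w. h w * A) p"
proof -
  show "A * lift h p = lift (\<lambda>w. A * h w) p"
    by (rule endo_eqI) (simp add: lift_def act_def lin_ext_lin_ext)
  show "lift h p * A = lift (\<lambda>w. h w * A) p"
    by (rule endo_eqI) (simp add: act_lift, simp add: lift_def)
qed

definition word_act :: "('g \<Rightarrow> ('i, 'k::field) endo) \<Rightarrow> 'g word \<Rightarrow> ('i, 'k) endo" where
  "word_act \<rho> w = prod_list (map \<rho> (letters w))"

lemma word_act_simps [simp]:
  "word_act \<rho> 0 = 1" "word_act \<rho> (v + w) = word_act \<rho> v * word_act \<rho> w"
  "word_act \<rho> (Word []) = 1" "word_act \<rho> (Word (g # gs)) = \<rho> g * word_act \<rho> (Word gs)"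
  by (simp_all add: word_act_def zero_word_def plus_word_def)

definition rep :: "('g \<Rightarrow> ('i, 'k::field) endo) \<Rightarrow> ('g word \<Rightarrow>\<^sub>0 'k) \<Rightarrow> ('i, 'k) endo" where
  "rep \<rho> = lift (word_act \<rho>)"

lemma scal_eq_scale: "scal c = scale c 1"
  by (simp add: scal_def single_eq_scale one_eq_basis_vec)

lemma rep_simps [simp]:
  "rep \<rho> (p + q) = rep \<rho> p + rep \<rho> q" "rep \<rho> (p - q) = rep \<rho> p - rep \<rho> q"
  "rep \<rho> (p * q) = rep \<rho> p * rep \<rho> q" "rep \<rho> 0 = 0" "rep \<rho> 1 = 1"
  "rep \<rho> (scale c p) = smul c (rep \<rho> p)" "rep \<rho> (basis_vec w) = word_act \<rho> w"
  by (simp_all add: rep_def lift_mult one_eq_basis_vec)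

lemma rep_gelt [simp]: "rep \<rho> (gelt g) = \<rho> g"
  by (simp add: gelt_def)

lemma rep_scal [simp]: "rep \<rho> (scal c) = smul c 1"
  by (simp add: scal_eq_scale)

text \<open>The empty word acts as 1 and not as \<open>u\<close>, so words land in the corner only
  after multiplication by \<open>u\<close> on the right.\<close>

lemma (in gl_rep) word_act_corner:
  assumes "set (letters w) \<subseteq> gens n"
  shows "u * (word_act \<rho> w * u) = word_act \<rho> w * u"
proof -
  have "u * (word_act \<rho> (Word gs) * u) = word_act \<rho> (Word gs) * u" if "set gs \<subseteq> gens n" for gs
  proof (cases gs)
    case (Cons g gs')
    then have "u * \<rho> g = \<rho> g"
      using that by (simp add: corner)
    then show ?thesis
      by (simp add: Cons mult.assoc[symmetric])
  qed (simp add: idem)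
  from this[of "letters w"] show ?thesis
    using assms by simp
qed

lemma (in gl_rep) rep_corner:
  assumes "p \<in> carrier (free_alg (gens n))"
  shows "u * (rep \<rho> p * u) = rep \<rho> p * u"
  unfolding rep_def mult_lift
  by (rule lift_cong) (use assms in \<open>auto simp: free_alg_def intro: word_act_corner\<close>)

text \<open>The factor \<open>u\<close> absorbs the difference between the two units: the inverse
  relations give \<open>u\<close> on one side and 1 on the other.\<close>

lemma (in gl_rep) rep_defrel:
  assumes "defrel n r s p q"
  shows "rep \<rho> p * u = rep \<rho> q * u"
  using assms
proof cases
  case (R1_comm x y)
  then show ?thesis
    by (simp add: torus[of x y])
next
  case (R4 i j)
  then have "rep \<rho> p = rep \<rho> q"
    by (simp add: e_f)
  then show ?thesis
    by simp
next
  case (R6_1 i)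
  then show ?thesis
    using e_serre1[of i] by (simp add: power2_eq_square mult.assoc)
next
  case (R6_2 i)
  then show ?thesis
    using e_serre2[of i] by (simp add: power2_eq_square mult.assoc)
next
  case (R7_1 i)
  then show ?thesis
    using f_serre1[of i] by (simp add: power2_eq_square mult.assoc)
next
  case (R7_2 i)
  then show ?thesis
    using f_serre2[of i] by (simp add: power2_eq_square mult.assoc)
qed (simp_all add: a_inv b_inv idem a_e a_f b_e b_f e_comm f_comm)

primrec tpow_proj :: "nat \<Rightarrow> nat \<Rightarrow> (nat list, 'k::field) endo" where
  "tpow_proj n 0 = projection {[]}"
| "tpow_proj n (Suc k) = projection {1..n} \<otimes>\<^sub>e tpow_proj n k"

primrec tpow_rep :: "nat \<Rightarrow> 'k::field \<Rightarrow> 'k \<Rightarrow> nat \<Rightarrow> gen \<Rightarrow> (nat list, 'k) endo" where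
  "tpow_rep n r s 0 = triv_rep"
| "tpow_rep n r s (Suc k) =
    tensor_rep (projection {1..n}) (tpow_proj n k) (nat_rep n r s) (tpow_rep n r s k)"

lemma gl_rep_tpow:
  assumes "r \<noteq> 0" "s \<noteq> 0" "r \<noteq> s"
  shows "gl_rep n r s (tpow_proj n k) (tpow_rep n r s k)"
  using assms by (induction k) (simp_all add: gl_rep_triv gl_rep_tensor gl_rep_nat del: One_nat_def)

subsection \<open>Comparison with the action through the comultiplication\<close>

text \<open>Unlike \<open>tpow_rep\<close>, the following operators use the identity in place of the projection onto the
  module, just as the action of the comultiplication does.\<close>

primrec raw_rep :: "nat \<Rightarrow> 'k::field \<Rightarrow> 'k \<Rightarrow> nat \<Rightarrow> gen \<Rightarrow> (nat list, 'k) endo" where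
  "raw_rep n r s 0 = (\<lambda>g. smul (counit_gen g) 1)"
| "raw_rep n r s (Suc k) = tensor_rep 1 1 (nat_rep n r s) (raw_rep n r s k)"

lemma nat_act_basis_vec: "nat_act n r s (basis_vec w) x = act (word_act (nat_rep n r s) w) x"
proof -
  have "foldr (nat_gen n r s) gs x = act (word_act (nat_rep n r s) (Word gs)) x" for gs
    by (induction gs) (simp_all add: act_nat_rep)
  from this[of "letters w"] show ?thesis
    by (simp add: nat_act_def)
qed

lemma lift_comult_gen:
  assumes "\<phi> = (\<lambda>(v, w). word_act \<rho> v \<otimes>\<^sub>e word_act \<sigma> w)"
  shows "lift \<phi> (comult_gen g) = tensor_rep 1 1 \<rho> \<sigma> g"
proof -
  have Word: "gelt g = basis_vec (Word [g])" "1 = basis_vec (Word [])" for g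
    by (simp_all add: gelt_def one_eq_basis_vec zero_word_def)
  show ?thesis
    by (cases g) (simp_all only: comult_gen.simps omega_def omega'_def Word basis_vec_mult
        tens_basis_vec lift_simps assms plus_word_def; simp)+
qed

text \<open>\<open>\<phi>\<close> is multiplicative on pairs of words, so the comparison reduces to
  generators. The factor \<open>1 \<otimes>\<^sub>e 1\<close> remains because it is the value of
  \<open>lift \<phi>\<close> at 1, and it is not the identity.\<close>

lemma lift_comult:
  assumes \<phi>: "\<phi> = (\<lambda>(v, w). word_act \<rho> v \<otimes>\<^sub>e word_act \<sigma> w)"
  shows "lift \<phi> (comult p) = rep (tensor_rep 1 1 \<rho> \<sigma>) p * (1 \<otimes>\<^sub>e 1)"
proof -
  have hom: "\<phi> (v + w) = \<phi> v * \<phi> w" for v w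
    by (simp add: \<phi> case_prod_unfold)
  have "lift \<phi> (prod_list (map comult_gen gs)) = word_act (tensor_rep 1 1 \<rho> \<sigma>) (Word gs) * (1 \<otimes>\<^sub>e 1)" for gs
  proof (induction gs)
    case Nil
    have "lift \<phi> 1 = 1 \<otimes>\<^sub>e 1"
      by (simp add: one_eq_basis_vec \<phi> zero_prod_def)
    then show ?case by simp
  next
    case (Cons g gs)
    then show ?case
      by (simp add: lift_mult hom lift_comult_gen[OF \<phi>] mult.assoc)
  qed
  from this[of "letters _"] show ?thesis
    by (simp add: comult_def alg_ext_def lift_lin_ext rep_def mult_lift)
qed

text \<open>In the induction step the comultiplication yields the operator of \<open>p\<close> after
  \<open>1 \<otimes>\<^sub>e 1\<close>. The latter kills the empty list, and the hypothesis on
  lengths makes it fix \<open>x\<close>.\<close>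

lemma tpow_act_raw:
  assumes "\<And>is. is \<in> Poly_Mapping.keys x \<Longrightarrow> length is = k"
  shows "tpow_act n r s k p x = act (rep (raw_rep n r s k) p) x"
  using assms
proof (induction k arbitrary: p x)
  case 0
  have "word_act (raw_rep n r s 0) (Word gs) = smul (prod_list (map counit_gen gs)) 1" for gs
    by (induction gs) (simp_all add: mult.commute)
  from this[of "letters _"] show ?case
    by (simp add: rep_def act_lift counit_def lin_ext_def scale.scale_sum_left)
next
  case (Suc k)
  define \<phi> where "\<phi> = (\<lambda>(v, w). word_act (nat_rep n r s) v \<otimes>\<^sub>e word_act (raw_rep n r s k) w)"
  have lin: "lin (\<lambda>x. tpow_act n r s (Suc k) p x)"
    by (rule linI) (simp_all add: tens_op_def case_prod_unfold lin_ext_fun_add lin_ext_fun_scale)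
  have "tpow_act n r s (Suc k) p x = act (lift \<phi> (comult p)) x"
  proof (rule lin_eqI[OF lin lin_act])
    fix "is" assume "is \<in> Poly_Mapping.keys x"
    then obtain i js where "is = i # js" and "length js = k"
      using Suc.prems by (metis length_Suc_conv)
    moreover have "tpow_act n r s k (basis_vec w) (basis_vec js)
        = act (word_act (raw_rep n r s k) w) (basis_vec js)" for w
      using \<open>length js = k\<close> by (subst Suc.IH) simp_all
    ultimately show "tpow_act n r s (Suc k) p (basis_vec is) = act (lift \<phi> (comult p)) (basis_vec is)"
      by (simp add: tens_op_def nat_act_basis_vec \<phi>_def case_prod_unfold lift_def)
  qed
  also have "\<dots> = act (rep (raw_rep n r s (Suc k)) p) (act (1 \<otimes>\<^sub>e 1) x)"
    by (simp add: lift_comult[OF \<phi>_def])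
  also have "act (1 \<otimes>\<^sub>e 1) x = x"
  proof (rule lin_eqI[OF lin_act scale.linear_ident])
    fix "is" assume "is \<in> Poly_Mapping.keys x"
    then obtain i js where "is = i # js"
      using Suc.prems by (metis length_Suc_conv)
    then show "act (1 \<otimes>\<^sub>e 1) (basis_vec is) = basis_vec is"
      by simp
  qed
  finally show ?case .
qed

lemma raw_rep_proj:
  fixes r s :: "'k::field"
  assumes "r \<noteq> 0" "s \<noteq> 0" "r \<noteq> s" and "g \<in> gens n"
  shows "raw_rep n r s k g * tpow_proj n k = tpow_rep n r s k g"
  using assms(4)
proof (induction k arbitrary: g)
  case 0
  show ?case by (simp add: triv_rep_def)
next
  case (Suc k)
  interpret N: gl_rep n r s "projection {1..n}" "nat_rep n r s"
    using assms(1-3) by (rule gl_rep_nat)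
  interpret T: gl_rep n r s "tpow_proj n k" "tpow_rep n r s k"
    using assms(1-3) by (rule gl_rep_tpow)
  note Suc.IH[simp]
  \<comment> \<open>Serves the torus product in the coproduct of f: only its last factor meets the
    projection, which is then inserted again in front so that the first factor meets it too.\<close>
  have [simp]: "raw_rep n r s k g * tpow_rep n r s k h = tpow_rep n r s k g * tpow_rep n r s k h"
    if "g \<in> gens n" "h \<in> gens n" for g h
  proof -
    have "raw_rep n r s k g * tpow_rep n r s k h
      = raw_rep n r s k g * (tpow_proj n k * tpow_rep n r s k h)"
      using that by (simp add: T.corner)
    then show ?thesis
      using that by (simp add: mult.assoc[symmetric])
  qed
  show ?case
    using Suc.prems
    by (cases g) (simp_all add: distrib_right N.corner mult.assoc del: One_nat_def)
qed

lemma tpow_act_eq: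
  fixes r s :: "'k::field"
  assumes "r \<noteq> 0" "s \<noteq> 0" "r \<noteq> s" and "p \<in> carrier (free_alg (gens n))"
    and x: "act (tpow_proj n k) x = x" and len: "\<And>is. is \<in> Poly_Mapping.keys x \<Longrightarrow> length is = k"
  shows "tpow_act n r s k p x = act (rep (tpow_rep n r s k) p) x"
proof -
  interpret T: gl_rep n r s "tpow_proj n k" "tpow_rep n r s k"
    using assms(1-3) by (rule gl_rep_tpow)
  let ?U = "tpow_proj n k"
  have "word_act (raw_rep n r s k) (Word gs) * ?U = word_act (tpow_rep n r s k) (Word gs) * ?U"
    if "set gs \<subseteq> gens n" for gs
    using that
  proof (induction gs)
    case (Cons g gs)
    then have "word_act (raw_rep n r s k) (Word (g # gs)) * ?U
        = raw_rep n r s k g * (word_act (tpow_rep n r s k) (Word gs) * ?U)"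
      by (simp add: mult.assoc)
    \<comment> \<open>The tail of the word maps into the module, so the projection can be inserted
      before the next letter acts.\<close>
    also have "\<dots> = raw_rep n r s k g * (?U * (word_act (tpow_rep n r s k) (Word gs) * ?U))"
      using Cons.prems by (simp add: T.word_act_corner)
    also have "\<dots> = tpow_rep n r s k g * (word_act (tpow_rep n r s k) (Word gs) * ?U)"
      using Cons.prems raw_rep_proj[OF assms(1-3)] by (simp add: mult.assoc[symmetric])
    finally show ?case
      by (simp add: mult.assoc)
  qed simp
  from this[of "letters _"] have "rep (raw_rep n r s k) p * ?U = rep (tpow_rep n r s k) p * ?U"
    unfolding rep_def mult_lift using assms(4) by (intro lift_cong) (auto simp: free_alg_def)
  then have "act (rep (raw_rep n r s k) p) (act ?U x) = act (rep (tpow_rep n r s k) p) (act ?U x)"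
    by (metis act_endo_simps(5))
  then show ?thesis
    by (simp add: x tpow_act_raw len)
qed

section \<open>The tensor power as the image of a projection\<close>

lemma keys_lin_ext: "Poly_Mapping.keys (lin_ext h x) \<subseteq> (\<Union>i\<in>Poly_Mapping.keys x. Poly_Mapping.keys (h i))"
proof
  fix j assume "j \<in> Poly_Mapping.keys (lin_ext h x)"
  then have "(\<Sum>i\<in>Poly_Mapping.keys x. Poly_Mapping.lookup x i * Poly_Mapping.lookup (h i) j) \<noteq> 0"
    by (simp add: in_keys_iff lin_ext_def lookup_sum)
  then obtain i where "i \<in> Poly_Mapping.keys x" "Poly_Mapping.lookup x i * Poly_Mapping.lookup (h i) j \<noteq> 0"
    using sum.not_neutral_contains_not_neutral by blast
  then show "j \<in> (\<Union>i\<in>Poly_Mapping.keys x. Poly_Mapping.keys (h i))"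
    by (auto simp: in_keys_iff)
qed

lemma col_tpow_proj:
  "col (tpow_proj n k) is = (if length is = k \<and> set is \<subseteq> {1..n} then basis_vec is else 0)"
proof (induction k arbitrary: "is")
  case (Suc k)
  then show ?case by (cases "is") auto
qed simp

lemma tensor_power_carrier: "x \<in> carrier (tensor_power n r s k) \<longleftrightarrow>
    (\<forall>is\<in>Poly_Mapping.keys x. length is = k \<and> set is \<subseteq> {1..n})"
  by (simp add: tensor_power_def)

text \<open>Turns membership into a fixed point equation, from which closure under sums and under
  the action follows by algebra.\<close>

lemma tensor_power_carrier_iff: "x \<in> carrier (tensor_power n r s k) \<longleftrightarrow> act (tpow_proj n k) x = x"
proof
  assume x: "x \<in> carrier (tensor_power n r s k)"
  show "act (tpow_proj n k) x = x"
    by (rule lin_eqI[OF lin_act scale.linear_ident])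
      (use x in \<open>simp add: tensor_power_carrier col_tpow_proj\<close>)
next
  assume "act (tpow_proj n k) x = x"
  then have "Poly_Mapping.keys x \<subseteq> (\<Union>is\<in>Poly_Mapping.keys x. Poly_Mapping.keys (col (tpow_proj n k) is :: _ \<Rightarrow>\<^sub>0 'a))"
    using keys_lin_ext[of "col (tpow_proj n k)" x] by (simp add: act_def)
  then show "x \<in> carrier (tensor_power n r s k)"
    unfolding tensor_power_carrier by (auto simp: col_tpow_proj subset_iff split: if_splits)
qed

section \<open>The quotient algebra and its action\<close>

lemma free_alg_simps [simp]:
  "monoid.mult (free_alg G) = (*)" "one (free_alg G) = 1" "zero (free_alg G) = 0" "add (free_alg G) = (+)"
  by (simp_all add: free_alg_def)

lemma free_alg_carrier:
  "p \<in> carrier (free_alg G) \<longleftrightarrow> (\<forall>w\<in>Poly_Mapping.keys p. set (letters w) \<subseteq> G)"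
  by (simp add: free_alg_def)

lemma free_alg_closed [simp]:
  "0 \<in> carrier (free_alg G)" "1 \<in> carrier (free_alg G)"
  by (auto simp: free_alg_carrier one_eq_basis_vec zero_word_def)

lemma free_alg_generators [simp]:
  "scal c \<in> carrier (free_alg G)"
  "gelt g \<in> carrier (free_alg G) \<longleftrightarrow> g \<in> G"
  by (auto simp: free_alg_carrier scal_def gelt_def one_eq_basis_vec zero_word_def)

lemma free_alg_closed_op [simp]:
  assumes "p \<in> carrier (free_alg G)" "q \<in> carrier (free_alg G)"
  shows "p + q \<in> carrier (free_alg G)" "p - q \<in> carrier (free_alg G)"
    "p * q \<in> carrier (free_alg G)"
proof -
  show "p * q \<in> carrier (free_alg G)"
    using assms keys_mult[of p q] by (fastforce simp: free_alg_carrier plus_word_def)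
  show "p + q \<in> carrier (free_alg G)" "p - q \<in> carrier (free_alg G)"
    using assms Poly_Mapping.keys_add[of p q] keys_diff[of p q]
    by (auto simp: free_alg_carrier subset_iff)
qed

lemma free_alg_uminus: "p \<in> carrier (free_alg G) \<Longrightarrow> - p \<in> carrier (free_alg G)"
  using free_alg_closed_op(2)[of 0 G p] by simp

lemma free_alg_power: "p \<in> carrier (free_alg G) \<Longrightarrow> p ^ m \<in> carrier (free_alg G)"
  by (induction m) simp_all

lemma ring_free_alg: "ring (free_alg G)"
proof (rule ringI)
  show "abelian_group (free_alg G)"
    by (rule abelian_groupI) (auto simp: algebra_simps intro: bexI[OF _ free_alg_uminus])
  show "Group.monoid (free_alg G)"
    by (rule Group.monoidI) (auto simp: mult.assoc)
qed (auto simp: algebra_simps)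

lemma defrel_carrier:
  assumes "defrel n r s p q"
  shows "p \<in> carrier (free_alg (gens n))" "q \<in> carrier (free_alg (gens n))"
  using assms
  by (induction) (auto intro!: free_alg_closed_op free_alg_power dest: subsetD[OF torus_gens_subset])

lemma ideal_rel_ideal: "ideal (rel_ideal n r s) (free_alg (gens n))"
  unfolding rel_ideal_def
  by (rule ring.genideal_ideal[OF ring_free_alg]) (auto simp: defrel_carrier)

lemma ring_U_gl: "ring (U_gl n r s)"
  unfolding U_gl_def by (rule ideal.quotient_is_ring[OF ideal_rel_ideal])

lemma rep_uminus: "rep \<rho> (- p) = - rep \<rho> p"
  using rep_simps(2)[of \<rho> 0 p] by simp

text \<open>The elements whose operators vanish on the corner form a two-sided ideal containing the
  defining relations. For multiplication on the right, \<open>rep_corner\<close> is essential: the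
  right factor preserves the corner, so \<open>u\<close> can be inserted between the two
  operators.\<close>

lemma (in gl_rep) rep_rel_ideal:
  assumes "p \<in> rel_ideal n r s"
  shows "rep \<rho> p * u = 0"
proof -
  let ?F = "free_alg (gens n) :: (gen word \<Rightarrow>\<^sub>0 'k) ring"
  interpret F: ring ?F by (rule ring_free_alg)
  let ?K = "{p \<in> carrier ?F. rep \<rho> p * u = 0}"
  have "ideal ?K ?F"
  proof (rule idealI[OF ring_free_alg])
    have "inv\<^bsub>add_monoid ?F\<^esub> a = - a" if "a \<in> carrier ?F" for a
      using that F.minus_equality[of "- a" a] by (simp add: free_alg_uminus a_inv_def)
    then show "subgroup ?K (add_monoid ?F)"
      by unfold_locales (auto simp: distrib_right free_alg_uminus rep_uminus)
  next
    fix a x assume a: "a \<in> ?K" and x: "x \<in> carrier ?F"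
    have "rep \<rho> a * (rep \<rho> x * u) = rep \<rho> a * u * (rep \<rho> x * u)"
      using rep_corner[OF x] by (simp add: mult.assoc)
    also have "\<dots> = 0"
      using a by simp
    finally have "rep \<rho> a * (rep \<rho> x * u) = 0" .
    then show "x \<otimes>\<^bsub>?F\<^esub> a \<in> ?K" "a \<otimes>\<^bsub>?F\<^esub> x \<in> ?K"
      using a x by (simp_all add: mult.assoc)
  qed
  moreover have "{p - q | p q. defrel n r s p q} \<subseteq> ?K"
    using rep_defrel by (auto simp: defrel_carrier left_diff_distrib)
  ultimately show ?thesis
    using assms F.genideal_minimal unfolding rel_ideal_def by blast
qed

abbreviation coset :: "nat \<Rightarrow> 'k::field \<Rightarrow> 'k \<Rightarrow> 'k falg \<Rightarrow> 'k falg set" where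
  "coset n r s p \<equiv> rel_ideal n r s +>\<^bsub>free_alg (gens n)\<^esub> p"

lemma U_gl_carrier: "Q \<in> carrier (U_gl n r s) \<longleftrightarrow> (\<exists>p\<in>carrier (free_alg (gens n)). Q = coset n r s p)"
  by (auto simp: U_gl_def FactRing_def A_RCOSETS_def')

text \<open>Justifies \<open>the_elem\<close>: two representatives differ by an element of
  \<open>rel_ideal\<close>, which kills \<open>x\<close> because the projection fixes
  \<open>x\<close>. So the image of the coset is a singleton.\<close>

lemma smult_coset:
  fixes r s :: "'k::field"
  assumes "r \<noteq> 0" "s \<noteq> 0" "r \<noteq> s"
    and p: "p \<in> carrier (free_alg (gens n))" and x: "x \<in> carrier (tensor_power n r s k)"
  shows "coset n r s p \<odot>\<^bsub>tensor_power n r s k\<^esub> x = act (rep (tpow_rep n r s k) p) x"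
proof -
  interpret T: gl_rep n r s "tpow_proj n k" "tpow_rep n r s k"
    using assms(1-3) by (rule gl_rep_tpow)
  interpret I: ideal "rel_ideal n r s" "free_alg (gens n)" by (rule ideal_rel_ideal)
  have x': "act (tpow_proj n k) x = x"
    using x by (simp add: tensor_power_carrier_iff)
  have act: "tpow_act n r s k q x = act (rep (tpow_rep n r s k) q) x"
    if "q \<in> carrier (free_alg (gens n))" for q
    using that x x' by (intro tpow_act_eq[OF assms(1-3)]) (auto simp: tensor_power_carrier)
  have "tpow_act n r s k q x = act (rep (tpow_rep n r s k) p) x" if q: "q \<in> coset n r s p" for q
  proof -
    obtain h where h: "h \<in> rel_ideal n r s" "q = h + p"
      using q by (auto simp: a_r_coset_def')
    have "act (rep (tpow_rep n r s k) h) (act (tpow_proj n k) x) = 0"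
      using T.rep_rel_ideal[OF h(1)] by (metis act_endo_simps(1,5))
    then show ?thesis
      using h p I.Icarr by (simp add: act x')
  qed
  moreover have "p \<in> coset n r s p"
    using I.a_rcos_self p by simp
  ultimately have "(\<lambda>q. tpow_act n r s k q x) ` coset n r s p = {act (rep (tpow_rep n r s k) p) x}"
    by (auto simp: image_iff intro!: bexI[of _ p])
  then show ?thesis
    by (simp add: tensor_power_def)
qed

lemma left_module_tensor_power:
  fixes r s :: "'k::field"
  assumes "r \<noteq> 0" "s \<noteq> 0" "r \<noteq> s"
  shows "left_module (U_gl n r s) (tensor_power n r s k)"
proof -
  interpret T: gl_rep n r s "tpow_proj n k" "tpow_rep n r s k"
    using assms by (rule gl_rep_tpow)
  let ?V = "tensor_power n r s k" and ?F = "free_alg (gens n) :: (gen word \<Rightarrow>\<^sub>0 'k) ring"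
  interpret I: ideal "rel_ideal n r s" ?F by (rule ideal_rel_ideal)
  have [simp]: "add ?V = (+)" "zero ?V = 0"
    by (simp_all add: tensor_power_def)
  have add_closed: "x + y \<in> carrier ?V" if "x \<in> carrier ?V" "y \<in> carrier ?V" for x y
    using that by (simp add: tensor_power_carrier_iff)
  have uminus_closed: "- x \<in> carrier ?V" if "x \<in> carrier ?V" for x
    using that lin_minus[OF lin_act, of "tpow_proj n k" 0 x] by (simp add: tensor_power_carrier_iff)
  have rep_closed: "act (rep (tpow_rep n r s k) p) x \<in> carrier ?V"
    if "p \<in> carrier ?F" "x \<in> carrier ?V" for p x
    using that T.rep_corner[OF that(1)] unfolding tensor_power_carrier_iff
    by (metis act_endo_simps(5))
  \<comment> \<open>Passing to cosets is a ring homomorphism; read from right to left, it moves the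
    operations of the quotient to representatives, where \<open>rep\<close> is
    multiplicative.\<close>
  note hom = ring_hom_add[OF I.rcos_ring_hom] ring_hom_mult[OF I.rcos_ring_hom]
    ring_hom_one[OF I.rcos_ring_hom]
  note hom' = hom[folded U_gl_def, simplified, symmetric]
  show ?thesis
  proof (intro left_module.intro left_module_axioms.intro)
    show "ring (U_gl n r s)" by (rule ring_U_gl)
    show "abelian_group ?V"
      by (rule abelian_groupI) (auto simp: algebra_simps add_closed tensor_power_carrier_iff[of 0]
          intro: bexI[OF _ uminus_closed])
  next
    fix a x assume "a \<in> carrier (U_gl n r s)" "x \<in> carrier ?V"
    then show "a \<odot>\<^bsub>?V\<^esub> x \<in> carrier ?V"
      by (auto simp: U_gl_carrier smult_coset[OF assms] rep_closed)
    fix y assume "y \<in> carrier ?V"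
    then show "a \<odot>\<^bsub>?V\<^esub> (x \<oplus>\<^bsub>?V\<^esub> y) = a \<odot>\<^bsub>?V\<^esub> x \<oplus>\<^bsub>?V\<^esub> a \<odot>\<^bsub>?V\<^esub> y"
      using \<open>a \<in> _\<close> \<open>x \<in> _\<close> by (auto simp: U_gl_carrier smult_coset[OF assms] add_closed)
  next
    fix a b x assume "a \<in> carrier (U_gl n r s)" "b \<in> carrier (U_gl n r s)" "x \<in> carrier ?V"
    then show "(a \<oplus>\<^bsub>U_gl n r s\<^esub> b) \<odot>\<^bsub>?V\<^esub> x = a \<odot>\<^bsub>?V\<^esub> x \<oplus>\<^bsub>?V\<^esub> b \<odot>\<^bsub>?V\<^esub> x"
      "(a \<otimes>\<^bsub>U_gl n r s\<^esub> b) \<odot>\<^bsub>?V\<^esub> x = a \<odot>\<^bsub>?V\<^esub> (b \<odot>\<^bsub>?V\<^esub> x)"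
      by (auto simp: U_gl_carrier hom' smult_coset[OF assms] rep_closed)
  next
    fix x assume "x \<in> carrier ?V"
    then show "\<one>\<^bsub>U_gl n r s\<^esub> \<odot>\<^bsub>?V\<^esub> x = x"
      by (simp add: hom' smult_coset[OF assms])
  qed
qed

section \<open>Reaching all words by elementary moves\<close>

text \<open>Words of length \<open>k\<close> are represented by functions on \<open>{..<k}\<close>. A move may only touch a letter
  that occurs once: then a generator maps the basis vector to a nonzero multiple of another one, and no
  quantum integers, which vanish at roots of unity, enter.\<close>

locale word_moves =
  fixes n k :: nat and R :: "(nat \<Rightarrow> nat) \<Rightarrow> bool"
  assumes le: "k \<le> n"
    and base: "R Suc"
    and ext: "\<lbrakk>R f; \<And>i. i < k \<Longrightarrow> f i = g i\<rbrakk> \<Longrightarrow> R g"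
    and down: "\<lbrakk>R f; f ` {..<k} \<subseteq> {1..n}; p < k; f p = Suc j; 1 \<le> j;
      \<And>q. \<lbrakk>q < k; q \<noteq> p\<rbrakk> \<Longrightarrow> f q \<noteq> Suc j\<rbrakk> \<Longrightarrow> R (f(p := j))"
    and up: "\<lbrakk>R f; f ` {..<k} \<subseteq> {1..n}; p < k; f p = j; Suc j \<le> n;
      \<And>q. \<lbrakk>q < k; q \<noteq> p\<rbrakk> \<Longrightarrow> f q \<noteq> j\<rbrakk> \<Longrightarrow> R (f(p := Suc j))"
    and swap: "\<lbrakk>R f; f ` {..<k} \<subseteq> {1..n}; p < k; q < k; f p = j; f q = Suc j;
      \<And>i. \<lbrakk>i < k; i \<noteq> p; i \<noteq> q\<rbrakk> \<Longrightarrow> f i \<noteq> j \<and> f i \<noteq> Suc j\<rbrakk>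
      \<Longrightarrow> R (f(p := Suc j, q := j))"
begin

text \<open>In the word of a permutation each of the letters 1, ..., k occurs exactly once, so
  \<open>swap\<close> applies to any two neighbouring letters. The letter of the value
  \<open>a\<close> is \<open>Suc a\<close>.\<close>

lemma adjacent_transpose:
  assumes "R (Suc \<circ> \<pi>)" and \<pi>: "\<pi> permutes {..<k}" and a: "Suc a < k"
  shows "R (Suc \<circ> (transpose a (Suc a) \<circ> \<pi>))"
proof -
  have bound: "\<pi> i < k" if "i < k" for i
    using permutes_in_image[OF \<pi>, of i] that by simp
  have img: "(Suc \<circ> \<pi>) ` {..<k} \<subseteq> {1..n}"
    using bound le by (fastforce simp: Suc_le_eq)
  have "a \<in> \<pi> ` {..<k}" "Suc a \<in> \<pi> ` {..<k}"
    using permutes_image[OF \<pi>] a by auto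
  then obtain p q where pq: "\<pi> p = a" "\<pi> q = Suc a" and lt: "p < k" "q < k"
    by auto
  have inj: "\<pi> i \<noteq> a" "\<pi> i \<noteq> Suc a" if "i \<noteq> p" "i \<noteq> q" for i
    using that inj_eq[OF permutes_inj[OF \<pi>], of i p] inj_eq[OF permutes_inj[OF \<pi>], of i q]
    by (simp_all add: pq)
  have "R ((Suc \<circ> \<pi>)(p := Suc (Suc a), q := Suc a))"
    using swap[OF assms(1) img lt, of "Suc a"] pq inj by simp
  then show ?thesis
  proof (rule ext)
    show "((Suc \<circ> \<pi>)(p := Suc (Suc a), q := Suc a)) i = (Suc \<circ> (transpose a (Suc a) \<circ> \<pi>)) i" for i
      using pq inj[of i] by (cases "i = p"; cases "i = q") auto
  qed
qed

text \<open>Conjugating the transposition of \<open>a\<close> and \<open>b\<close> by that of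
  \<open>b\<close> and \<open>Suc b\<close> gives the one of \<open>a\<close> and
  \<open>Suc b\<close>, so three applications of earlier cases suffice.\<close>

lemma transpose_lt:
  assumes "a < b" and "b < k" and "R (Suc \<circ> \<pi>)" and "\<pi> permutes {..<k}"
  shows "R (Suc \<circ> (transpose a b \<circ> \<pi>))"
  using assms
proof (induction b arbitrary: \<pi>)
  case (Suc b)
  show ?case
  proof (cases "a = b")
    case True
    show ?thesis
      unfolding True by (rule adjacent_transpose[OF Suc.prems(3,4,2)])
  next
    case False
    let ?t = "transpose b (Suc b)"
    have t: "?t permutes {..<k}" "transpose a b permutes {..<k}"
      using Suc.prems by (auto intro!: permutes_swap_id)
    have *: "R (Suc \<circ> (?t \<circ> \<pi>))"
      by (rule adjacent_transpose[OF Suc.prems(3,4,2)])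
    have "R (Suc \<circ> (transpose a b \<circ> (?t \<circ> \<pi>)))"
      by (rule Suc.IH[OF _ _ * permutes_compose[OF Suc.prems(4) t(1)]])
        (use Suc.prems(1,2) False in simp_all)
    then have "R (Suc \<circ> (?t \<circ> (transpose a b \<circ> (?t \<circ> \<pi>))))"
      by (rule adjacent_transpose) (intro permutes_compose Suc.prems t)+
    moreover have "?t \<circ> transpose a b \<circ> ?t = transpose a (Suc b)"
      using transpose_comp_triple[of "Suc b" a b] False Suc.prems
      by (simp add: transpose_commute)
    then have "?t \<circ> (transpose a b \<circ> (?t \<circ> \<pi>)) = transpose a (Suc b) \<circ> \<pi>"
      by (metis o_assoc)
    ultimately show ?thesis
      by (simp only:)
  qed
qed simp

lemma permutation:
  assumes "\<pi> permutes {..<k}"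
  shows "R (Suc \<circ> \<pi>)"
  using assms finite_lessThan
proof (induction rule: permutes_induct)
  case id
  then show ?case using base by simp
next
  case (swap a b p)
  then show ?case
    by (metis lessThan_iff linorder_neqE_nat transpose_commute transpose_lt)
qed

text \<open>The monotone map \<open>t\<close> sends the letter \<open>Suc i\<close> to \<open>t i\<close>. First the letters that move down do so,
  starting with the smallest one, then those that move up, starting with the largest one, so that a
  moving letter never meets another one before its destination. The induction follows these moves backwards.\<close>

lemma monotone:
  assumes "\<pi> permutes {..<k}" and "mono_on {..<k} t" and "t ` {..<k} \<subseteq> {1..n}"
  shows "R (t \<circ> \<pi>)"
  using assms(2,3)
\<comment> \<open>The measure is the total distance of the letters from their starting values;
  undoing a move lowers it.\<close>
proof (induction "\<Sum>i<k. nat \<bar>int (t i) - int (Suc i)\<bar>" arbitrary: t rule: less_induct)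
  case less
  note \<pi> = assms(1)
  have mono: "t a \<le> t b" if "a \<le> b" "b < k" for a b
    using less.prems(1) that by (auto simp: mono_on_def)
  have decr: "(\<Sum>l<k. nat \<bar>int ((t(i := c)) l) - int (Suc l)\<bar>) < (\<Sum>l<k. nat \<bar>int (t l) - int (Suc l)\<bar>)"
    if "i < k" "nat \<bar>int c - int (Suc i)\<bar> < nat \<bar>int (t i) - int (Suc i)\<bar>" for i c
    by (rule sum_strict_mono_ex1) (use that in \<open>auto intro!: bexI[of _ i]\<close>)
  have img: "(f \<circ> \<pi>) ` {..<k} \<subseteq> {1..n}" if "f ` {..<k} \<subseteq> {1..n}" for f
    by (simp only: image_comp[symmetric] permutes_image[OF \<pi>] that)
  have pos: "\<exists>q<k. \<pi> q = i" if "i < k" for i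
    using that permutes_image[OF \<pi>] by (metis (no_types) imageE lessThan_iff)
  have upd: "R (t \<circ> \<pi>)" if "R ((f \<circ> \<pi>)(q := t i))" "\<pi> q = i" "\<And>l. l \<noteq> i \<Longrightarrow> f l = t l" for f q i
    using that(1)
  proof (rule ext)
    show "((f \<circ> \<pi>)(q := t i)) l = (t \<circ> \<pi>) l" for l
      using that(2,3) inj_eq[OF permutes_inj[OF \<pi>], of l q] by auto
  qed
  \<comment> \<open>Upward moves come last, so they are undone first; a downward move is undone only
    when no letter has risen.\<close>
  consider (id) "\<forall>i<k. t i = Suc i" | (gt) "\<exists>i<k. Suc i < t i"
    | (lt) "\<forall>i<k. t i \<le> Suc i" "\<exists>i<k. t i < Suc i"
    by (meson linorder_neqE_nat not_le)
  then show ?case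
  proof cases
    case id
    have "R (Suc \<circ> \<pi>)" using permutation \<pi> .
    then show ?thesis
      by (rule ext) (use id permutes_in_image[OF \<pi>] in auto)
  next
    case gt
    \<comment> \<open>The smallest rising letter moves up last. One step before its end it has the
      value \<open>t i - 1\<close>, which no other letter has: smaller ones stay at or below
      \<open>Suc l\<close>, larger ones are at \<open>t i\<close> or above.\<close>
    define i where "i = (LEAST i. i < k \<and> Suc i < t i)"
    have i: "i < k" "Suc i < t i"
      using LeastI_ex[of "\<lambda>i. i < k \<and> Suc i < t i"] gt by (auto simp: i_def)
    have before: "t l \<le> Suc l" if "l < i" for l
      using not_less_Least[of l "\<lambda>i. i < k \<and> Suc i < t i"] that i by (auto simp: i_def[symmetric])
    define j where "j = t i - 1"
    have j: "t i = Suc j" "Suc i \<le> j" "Suc j \<le> n"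
      using i less.prems(2) by (auto simp: j_def)
    let ?t = "t(i := j)"
    have mono': "mono_on {..<k} ?t"
    proof (rule mono_onI)
      fix a b assume "a \<in> {..<k}" "b \<in> {..<k}" "a \<le> b"
      then show "?t a \<le> ?t b"
        using j mono[of a b] before[of a] by (cases "a = i"; cases "b = i") auto
    qed
    have img': "?t ` {..<k} \<subseteq> {1..n}"
      using less.prems(2) j by auto
    obtain q where q: "q < k" "\<pi> q = i"
      using pos i by blast
    have R: "R (?t \<circ> \<pi>)"
      by (rule less.hyps[OF _ mono' img']) (rule decr, use i j in auto)
    have "R ((?t \<circ> \<pi>)(q := Suc j))"
    proof (rule up[OF R img[OF img'] q(1)])
      fix l assume l: "l < k" "l \<noteq> q"
      then have "\<pi> l < k" "\<pi> l \<noteq> i"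
        using q inj_eq[OF permutes_inj[OF \<pi>], of l q] permutes_in_image[OF \<pi>, of l] by auto
      then show "(?t \<circ> \<pi>) l \<noteq> j"
        using j before[of "\<pi> l"] mono[of i "\<pi> l"] by (cases "\<pi> l < i") auto
    qed (use q j in auto)
    then show ?thesis
      using upd[of ?t q i] q j by simp
  next
    case lt
    \<comment> \<open>The largest falling letter moves down last. One step before its end it has the
      value \<open>Suc (t i)\<close>, which is above all smaller letters and below the larger ones,
      which have not moved.\<close>
    define i where "i = Max {i. i < k \<and> t i < Suc i}"
    have "i \<in> {i. i < k \<and> t i < Suc i}"
      unfolding i_def using lt by (intro Max_in) auto
    then have i: "i < k" "t i < Suc i" by auto
    have after: "t l = Suc l" if "i < l" "l < k" for l
    proof (rule ccontr)
      assume "t l \<noteq> Suc l"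
      then have "l \<in> {i. i < k \<and> t i < Suc i}"
        using lt(1) that by force
      then have "l \<le> i"
        unfolding i_def by (intro Max_ge) auto
      then show False using that by simp
    qed
    let ?t = "t(i := Suc (t i))"
    have mono': "mono_on {..<k} ?t"
    proof (rule mono_onI)
      fix a b assume "a \<in> {..<k}" "b \<in> {..<k}" "a \<le> b"
      then show "?t a \<le> ?t b"
        using i mono[of a b] after[of b] by (cases "a = i"; cases "b = i") auto
    qed
    have ti: "1 \<le> t i" using less.prems(2) i by auto
    have img': "?t ` {..<k} \<subseteq> {1..n}"
      using less.prems(2) i le by auto
    obtain q where q: "q < k" "\<pi> q = i"
      using pos i by blast
    have R: "R (?t \<circ> \<pi>)"
      by (rule less.hyps[OF _ mono' img']) (rule decr, use i in auto)
    have "R ((?t \<circ> \<pi>)(q := t i))"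
    proof (rule down[OF R img[OF img'] q(1)])
      fix l assume l: "l < k" "l \<noteq> q"
      then have "\<pi> l < k" "\<pi> l \<noteq> i"
        using q inj_eq[OF permutes_inj[OF \<pi>], of l q] permutes_in_image[OF \<pi>, of l] by auto
      then show "(?t \<circ> \<pi>) l \<noteq> Suc (t i)"
        using i after[of "\<pi> l"] mono[of "\<pi> l" i] by (cases "\<pi> l < i") auto
    qed (use q ti in auto)
    then show ?thesis
      using upd[of ?t q i] q by simp
  qed
qed

text \<open>Sorting gives a monotone word, and the given word is a rearrangement of its places,
  which is the form that \<open>monotone\<close> covers.\<close>

lemma all_words:
  assumes "f ` {..<k} \<subseteq> {1..n}"
  shows "R f"
proof -
  let ?w = "map f [0..<k]"
  obtain \<pi> where \<pi>: "\<pi> permutes {..<length (sort ?w)}" "permute_list \<pi> (sort ?w) = ?w"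
    using mset_eq_permutation[of ?w "sort ?w"] by auto
  have perm: "\<pi> permutes {..<k}" using \<pi>(1) by simp
  have "R ((!) (sort ?w) \<circ> \<pi>)"
  proof (rule monotone[OF perm])
    show "mono_on {..<k} ((!) (sort ?w))"
      by (auto simp: mono_on_def intro!: sorted_nth_mono)
    have "sort ?w ! i \<in> {1..n}" if "i < k" for i
      using nth_mem[of i "sort ?w"] assms that by (auto simp: image_subset_iff)
    then show "(!) (sort ?w) ` {..<k} \<subseteq> {1..n}"
      by blast
  qed
  then show ?thesis
  proof (rule ext)
    fix i assume "i < k"
    then have "permute_list \<pi> (sort ?w) ! i = sort ?w ! \<pi> i"
      using \<pi>(1) by (intro permute_list_nth) auto
    then show "((!) (sort ?w) \<circ> \<pi>) i = f i"
      using \<pi>(2) \<open>i < k\<close> by simp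
  qed
qed

end

section \<open>Cyclicity\<close>

lemma pure_tensor_basis_vec: "pure_tensor (map basis_vec is) = basis_vec is"
  by (induction "is") (simp_all add: pure_tensor_def)

section \<open>The action of the generators on tensors of basis vectors\<close>

lemma nat_rep_torus:
  fixes r s :: "'k::field"
  assumes "r \<noteq> 0" "s \<noteq> 0" and "g \<in> torus_gens n" and "l \<in> {1..n}"
  shows "\<exists>c. c \<noteq> 0 \<and> col (nat_rep n r s g) l = scale c (basis_vec l)"
  using assms by (cases g) (auto simp: col_nat_rep intro: exI[of _ 1] exI[of _ "inverse _"])

text \<open>Torus generators are group-like, so their eigenvalues multiply along the tensor. That
  these are nonzero keeps all coefficients of e and f below nonzero.\<close>

lemma tpow_rep_torus:
  fixes r s :: "'k::field"
  assumes "r \<noteq> 0" "s \<noteq> 0" and "g \<in> torus_gens n" and "set is \<subseteq> {1..n}"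
  shows "\<exists>c. c \<noteq> 0 \<and> col (tpow_rep n r s (length is) g) is = scale c (basis_vec is)"
  using assms(4)
proof (induction "is")
  case Nil
  then show ?case
    using assms(3) by (cases g) (auto simp: triv_rep_def intro: exI[of _ 1])
next
  case (Cons i js)
  obtain c d where "c \<noteq> 0" "col (nat_rep n r s g) i = scale c (basis_vec i)"
      "d \<noteq> 0" "col (tpow_rep n r s (length js) g) js = scale d (basis_vec js)"
    using Cons nat_rep_torus[OF assms(1-3), of i] by auto
  then show ?case
    using assms(3) by (cases g) (auto intro!: exI[of _ "c * d"] simp: mult.commute)
qed

text \<open>Common shape of the actions of \<open>e\<^sub>j\<close> and \<open>f\<^sub>j\<close> on tensors of basis vectors:
  one letter \<open>a\<close> at a time is replaced by \<open>b\<close>.\<close>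

lemma replace_letter_sum:
  fixes D :: "nat list \<Rightarrow> nat list \<Rightarrow>\<^sub>0 'k::field"
  assumes Nil: "D [] = 0"
    and Cons: "\<And>i js. set (i # js) \<subseteq> A \<Longrightarrow> \<exists>c d. c \<noteq> 0 \<and> d \<noteq> 0 \<and>
      D (i # js) = (if i = a then scale c (basis_vec (b # js)) else 0)
        + scale d (tens (#) (basis_vec i) (D js))"
    and "set is \<subseteq> A"
  shows "\<exists>c. (\<forall>p. c p \<noteq> 0) \<and>
    D is = (\<Sum>p | p < length is \<and> is ! p = a. scale (c p) (basis_vec (is[p := b])))"
  using assms(3)
proof (induction "is")
  \<comment> \<open>The sum is empty; a nonzero constant is chosen since \<open>c\<close> must
    vanish nowhere, even at positions that do not occur.\<close>
  case Nil
  show ?case by (rule exI[of _ "\<lambda>_. 1"]) (simp add: assms(1))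
next
  case (Cons i js)
  then obtain e where e: "\<forall>p. e p \<noteq> 0"
      "D js = (\<Sum>p | p < length js \<and> js ! p = a. scale (e p) (basis_vec (js[p := b])))"
    by auto
  obtain c d where cd: "c \<noteq> 0" "d \<noteq> 0" "D (i # js) = (if i = a then scale c (basis_vec (b # js)) else 0)
        + scale d (tens (#) (basis_vec i) (D js))"
    using assms(2)[OF Cons.prems] by blast
  let ?S = "{p. p < length js \<and> js ! p = a}"
  \<comment> \<open>The first position takes the coefficient of the replaced head; those of the tail
    shift by one place and are rescaled.\<close>
  define f where "f = (\<lambda>p. case p of 0 \<Rightarrow> c | Suc q \<Rightarrow> d * e q)"
  let ?g = "\<lambda>p. scale (f p) (basis_vec ((i # js)[p := b]))"
  have set: "{p. p < length (i # js) \<and> (i # js) ! p = a} = (if i = a then {0} else {}) \<union> Suc ` ?S"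
  proof (rule Set.set_eqI)
    show "p \<in> {p. p < length (i # js) \<and> (i # js) ! p = a} \<longleftrightarrow> p \<in> (if i = a then {0} else {}) \<union> Suc ` ?S" for p
      by (cases p) auto
  qed
  have "scale d (tens (#) (basis_vec i) (D js)) = (\<Sum>p\<in>?S. ?g (Suc p))"
    by (simp add: e(2) lin_sum[OF lin_tens(2)] scale.scale_sum_right f_def)
  also have "\<dots> = sum ?g (Suc ` ?S)"
    by (simp add: sum.reindex)
  finally have "D (i # js) = sum ?g {p. p < length (i # js) \<and> (i # js) ! p = a}"
    unfolding set cd(3) by (subst sum.union_disjoint) (auto simp: f_def)
  moreover have "\<forall>p. f p \<noteq> 0"
    using cd e(1) by (auto simp: f_def split: nat.splits)
  ultimately show ?case by blast
qed

text \<open>The summand \<open>e \<otimes> 1\<close> of the coproduct replaces the first letter with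
  coefficient 1. The other one acts on the tail, with the nonzero eigenvalue of
  \<open>\<omega>\<close> at the first letter as coefficient.\<close>

lemma tpow_rep_e:
  fixes r s :: "'k::field"
  assumes "r \<noteq> 0" "s \<noteq> 0" and j: "j \<in> {1..<n}" and "set is \<subseteq> {1..n}"
  shows "\<exists>c. (\<forall>p. c p \<noteq> 0) \<and> col (tpow_rep n r s (length is) (GE j)) is =
    (\<Sum>p | p < length is \<and> is ! p = Suc j. scale (c p) (basis_vec (is[p := j])))"
proof (rule replace_letter_sum[where D = "\<lambda>is. col (tpow_rep n r s (length is) (GE j)) is", OF _ _ assms(4)])
  show "col (tpow_rep n r s (length []) (GE j)) [] = 0"
    by (simp add: triv_rep_def)
  fix i js assume *: "set (i # js) \<subseteq> {1..n}"
  obtain c d where cd: "c \<noteq> 0" "col (nat_rep n r s (GA j)) i = scale c (basis_vec i)"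
      "d \<noteq> 0" "col (nat_rep n r s (GB (Suc j))) i = scale d (basis_vec i)"
    using nat_rep_torus[OF assms(1,2), of "GA j" n i] nat_rep_torus[OF assms(1,2), of "GB (Suc j)" n i] j * by auto
  have "col (tpow_proj n (length js)) js = (basis_vec js :: _ \<Rightarrow>\<^sub>0 'k)"
    using * by (simp add: col_tpow_proj)
  then show "\<exists>c d. c \<noteq> 0 \<and> d \<noteq> 0 \<and> col (tpow_rep n r s (length (i # js)) (GE j)) (i # js) =
      (if i = Suc j then scale c (basis_vec (j # js)) else 0)
        + scale d (tens (#) (basis_vec i) (col (tpow_rep n r s (length js) (GE j)) js))"
    by (intro exI[of _ 1] exI[of _ "c * d"]) (auto simp: cd col_nat_rep(1) mult.commute)
qed

lemma tpow_rep_f: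
  fixes r s :: "'k::field"
  assumes "r \<noteq> 0" "s \<noteq> 0" and j: "j \<in> {1..<n}" and "set is \<subseteq> {1..n}"
  shows "\<exists>c. (\<forall>p. c p \<noteq> 0) \<and> col (tpow_rep n r s (length is) (GF j)) is =
    (\<Sum>p | p < length is \<and> is ! p = j. scale (c p) (basis_vec (is[p := Suc j])))"
proof (rule replace_letter_sum[where D = "\<lambda>is. col (tpow_rep n r s (length is) (GF j)) is", OF _ _ assms(4)])
  show "col (tpow_rep n r s (length []) (GF j)) [] = 0"
    by (simp add: triv_rep_def)
  fix i js assume *: "set (i # js) \<subseteq> {1..n}"
  let ?T = "tpow_rep n r s (length js)"
  obtain c d where cd: "c \<noteq> 0" "col (?T (GA (Suc j))) js = scale c (basis_vec js)"
      "d \<noteq> 0" "col (?T (GB j)) js = scale d (basis_vec js)"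
    using tpow_rep_torus[OF assms(1,2), of "GA (Suc j)" n js] tpow_rep_torus[OF assms(1,2), of "GB j" n js] j * by auto
  then show "\<exists>c d. c \<noteq> 0 \<and> d \<noteq> 0 \<and> col (tpow_rep n r s (length (i # js)) (GF j)) (i # js) =
      (if i = j then scale c (basis_vec (Suc j # js)) else 0)
        + scale d (tens (#) (basis_vec i) (col (?T (GF j)) js))"
    \<comment> \<open>Compared with e the witnesses are exchanged: the eigenvalue of
      \<open>\<omega>'\<close> on the tail goes with the replaced head, and the action on the tail
      has coefficient 1.\<close>
    using * by (intro exI[of _ "c * d"] exI[of _ 1]) (auto simp: cd col_nat_rep(2) mult.commute add.commute)
qed

section \<open>The cyclic submodule generated by the tensor of the first k basis vectors\<close>

context
  fixes n k :: nat and r s :: "'k::field"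
  assumes param: "r \<noteq> 0" "s \<noteq> 0" and le: "k \<le> n"
begin

text \<open>Formed with operators of the free algebra, so that cosets only enter in the final
  theorem.\<close>

definition orbit :: "(nat list \<Rightarrow>\<^sub>0 'k) set" where
  "orbit = {act (rep (tpow_rep n r s k) p) (basis_vec [1..<k + 1]) | p. p \<in> carrier (free_alg (gens n))}"

definition word_vec :: "(nat \<Rightarrow> nat) \<Rightarrow> nat list \<Rightarrow>\<^sub>0 'k" where
  "word_vec f = basis_vec (map f [0..<k])"

lemma orbit_add: "\<lbrakk>x \<in> orbit; y \<in> orbit\<rbrakk> \<Longrightarrow> x + y \<in> orbit"
  unfolding orbit_def by (fastforce intro: exI[of _ "_ + _"])

lemma orbit_act:
  assumes "x \<in> orbit" and "p \<in> carrier (free_alg (gens n))"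
  shows "act (rep (tpow_rep n r s k) p) x \<in> orbit"
proof -
  obtain q where "q \<in> carrier (free_alg (gens n))"
      "x = act (rep (tpow_rep n r s k) q) (basis_vec [1..<k + 1])"
    using assms(1) by (auto simp: orbit_def)
  then show ?thesis
    unfolding orbit_def using assms(2) by (auto intro!: exI[of _ "p * q"])
qed

lemma orbit_scale: "x \<in> orbit \<Longrightarrow> scale c x \<in> orbit"
  using orbit_act[of x "scal c"] by simp

lemma orbit_scaleD: "\<lbrakk>scale c x \<in> orbit; c \<noteq> 0\<rbrakk> \<Longrightarrow> x \<in> orbit"
  using orbit_scale[of "scale c x" "inverse c"] by simp

lemma orbit_diff: "\<lbrakk>x \<in> orbit; y \<in> orbit\<rbrakk> \<Longrightarrow> x - y \<in> orbit"
  using orbit_add[of x "scale (-1) y"] orbit_scale[of y "-1"] by simp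

lemma orbit_sum: "(\<And>i. i \<in> S \<Longrightarrow> f i \<in> orbit) \<Longrightarrow> sum f S \<in> orbit"
proof (induction S rule: infinite_finite_induct)
  case (insert i S)
  then show ?case by (simp add: orbit_add)
qed (use orbit_act[of "basis_vec [1..<k + 1]" 0] orbit_act in \<open>auto simp: orbit_def intro!: exI[of _ 0]\<close>)

lemma orbit_e:
  assumes "word_vec f \<in> orbit" and "f ` {..<k} \<subseteq> {1..n}" and "j \<in> {1..<n}"
  shows "\<exists>c. (\<forall>p. c p \<noteq> 0) \<and> (\<Sum>p | p < k \<and> f p = Suc j. scale (c p) (word_vec (f(p := j)))) \<in> orbit"
proof -
  let ?w = "map f [0..<k]"
  obtain c where c: "\<forall>p. c p \<noteq> 0" "col (tpow_rep n r s (length ?w) (GE j)) ?w =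
    (\<Sum>p | p < length ?w \<and> ?w ! p = Suc j. scale (c p) (basis_vec (?w[p := j])))"
    using tpow_rep_e[OF param assms(3), of ?w] assms(2) by (auto simp: atLeast0LessThan)
  have "(\<Sum>p | p < length ?w \<and> ?w ! p = Suc j. scale (c p) (basis_vec (?w[p := j])))
      = (\<Sum>p | p < k \<and> f p = Suc j. scale (c p) (word_vec (f(p := j))))"
    unfolding word_vec_def
    by (intro sum.cong arg_cong2[where f = scale] arg_cong[where f = basis_vec]) (auto intro!: nth_equalityI)
  then show ?thesis
    using c orbit_act[OF assms(1), of "gelt (GE j)"] assms(3) by (auto simp: word_vec_def)
qed

lemma orbit_f:
  assumes "word_vec f \<in> orbit" and "f ` {..<k} \<subseteq> {1..n}" and "j \<in> {1..<n}"
  shows "\<exists>c. (\<forall>p. c p \<noteq> 0) \<and> (\<Sum>p | p < k \<and> f p = j. scale (c p) (word_vec (f(p := Suc j)))) \<in> orbit"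
proof -
  let ?w = "map f [0..<k]"
  obtain c where c: "\<forall>p. c p \<noteq> 0" "col (tpow_rep n r s (length ?w) (GF j)) ?w =
    (\<Sum>p | p < length ?w \<and> ?w ! p = j. scale (c p) (basis_vec (?w[p := Suc j])))"
    using tpow_rep_f[OF param assms(3), of ?w] assms(2) by (auto simp: atLeast0LessThan)
  have "(\<Sum>p | p < length ?w \<and> ?w ! p = j. scale (c p) (basis_vec (?w[p := Suc j])))
      = (\<Sum>p | p < k \<and> f p = j. scale (c p) (word_vec (f(p := Suc j))))"
    unfolding word_vec_def
    by (intro sum.cong arg_cong2[where f = scale] arg_cong[where f = basis_vec]) (auto intro!: nth_equalityI)
  then show ?thesis
    using c orbit_act[OF assms(1), of "gelt (GF j)"] assms(3) by (auto simp: word_vec_def)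
qed

text \<open>Uniqueness of the letter leaves a single term in the sum of \<open>orbit_e\<close>, and
  its nonzero coefficient can be divided out.\<close>

lemma orbit_down:
  assumes "word_vec f \<in> orbit" "f ` {..<k} \<subseteq> {1..n}" "p < k" "f p = Suc j" "1 \<le> j"
    and "\<And>q. \<lbrakk>q < k; q \<noteq> p\<rbrakk> \<Longrightarrow> f q \<noteq> Suc j"
  shows "word_vec (f(p := j)) \<in> orbit"
proof -
  have "f p \<in> {1..n}" using assms(2,3) by blast
  then have "j \<in> {1..<n}" using assms(4,5) by simp
  then obtain c where "\<forall>p. c p \<noteq> 0"
      "(\<Sum>p | p < k \<and> f p = Suc j. scale (c p) (word_vec (f(p := j)))) \<in> orbit"
    using orbit_e[OF assms(1,2)] by blast
  moreover have "{p. p < k \<and> f p = Suc j} = {p}"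
    using assms(3,4,6) by auto
  ultimately show ?thesis
    using orbit_scaleD by auto
qed

lemma orbit_up:
  assumes "word_vec f \<in> orbit" "f ` {..<k} \<subseteq> {1..n}" "p < k" "f p = j" "Suc j \<le> n"
    and "\<And>q. \<lbrakk>q < k; q \<noteq> p\<rbrakk> \<Longrightarrow> f q \<noteq> j"
  shows "word_vec (f(p := Suc j)) \<in> orbit"
proof -
  have "f p \<in> {1..n}" using assms(2,3) by blast
  then have "j \<in> {1..<n}" using assms(4,5) by simp
  then obtain c where "\<forall>p. c p \<noteq> 0"
      "(\<Sum>p | p < k \<and> f p = j. scale (c p) (word_vec (f(p := Suc j)))) \<in> orbit"
    using orbit_f[OF assms(1,2)] by blast
  moreover have "{p. p < k \<and> f p = j} = {p}"
    using assms(3,4,6) by auto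
  ultimately show ?thesis
    using orbit_scaleD by auto
qed

text \<open>Applying \<open>e\<^sub>j\<close> and then \<open>f\<^sub>j\<close> gives a combination of the original word and the swapped one.\<close>

lemma orbit_swap:
  assumes f: "word_vec f \<in> orbit" "f ` {..<k} \<subseteq> {1..n}" and "p < k" "q < k" "f p = j" "f q = Suc j"
    and other: "\<And>i. \<lbrakk>i < k; i \<noteq> p; i \<noteq> q\<rbrakk> \<Longrightarrow> f i \<noteq> j \<and> f i \<noteq> Suc j"
  shows "word_vec (f(p := Suc j, q := j)) \<in> orbit"
proof -
  have "f p \<in> {1..n}" "f q \<in> {1..n}" using assms(2-4) by blast+
  then have j: "j \<in> {1..<n}" using assms(5,6) by simp
  have pq: "p \<noteq> q" using assms(5,6) by auto
  let ?g = "f(q := j)"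
  have g: "word_vec ?g \<in> orbit"
    by (rule orbit_down[OF f \<open>q < k\<close> \<open>f q = Suc j\<close>]) (use j other assms(5) in force)+
  have "?g ` {..<k} \<subseteq> {1..n}"
    using f(2) j by auto
  then obtain c where c: "\<forall>p. c p \<noteq> 0"
      "(\<Sum>i | i < k \<and> ?g i = j. scale (c i) (word_vec (?g(i := Suc j)))) \<in> orbit"
    using orbit_f[OF g _ j] by blast
  \<comment> \<open>After e both places carry the letter \<open>j\<close>, so f acts at either one:
    at \<open>q\<close> it restores \<open>f\<close>, at \<open>p\<close> it completes the exchange.
    The multiple of \<open>f\<close> is then subtracted.\<close>
  have "{i. i < k \<and> ?g i = j} = {p, q}"
    using assms(3-5) other by auto
  then have "scale (c p) (word_vec (?g(p := Suc j))) + scale (c q) (word_vec (?g(q := Suc j))) \<in> orbit"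
    using c(2) pq by simp
  moreover have "?g(q := Suc j) = f"
    using assms(6) by auto
  ultimately have "scale (c p) (word_vec (?g(p := Suc j))) + scale (c q) (word_vec f) \<in> orbit"
    by simp
  from orbit_diff[OF this orbit_scale[OF f(1), of "c q"]] have "scale (c p) (word_vec (?g(p := Suc j))) \<in> orbit"
    by simp
  then show ?thesis
    using c(1) orbit_scaleD pq by (simp add: fun_upd_twist)
qed

lemma word_moves_orbit: "word_moves n k (\<lambda>f. word_vec f \<in> orbit)"
proof
  \<comment> \<open>Places count from 0 and letters from 1, so the generator is the word of
    \<open>Suc\<close>.\<close>
  have "word_vec Suc = basis_vec [1..<k + 1]"
    by (simp add: word_vec_def map_Suc_upt)
  then show "word_vec Suc \<in> orbit"
    unfolding orbit_def by (auto intro!: exI[of _ 1])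
  fix f g :: "nat \<Rightarrow> nat" assume "word_vec f \<in> orbit" "\<And>i. i < k \<Longrightarrow> f i = g i"
  moreover from this(2) have "map f [0..<k] = map g [0..<k]" by simp
  ultimately show "word_vec g \<in> orbit" by (simp add: word_vec_def)
qed (rule le orbit_down orbit_up orbit_swap; assumption)+

lemma carrier_subset_orbit: "carrier (tensor_power n r s k) \<subseteq> orbit"
proof
  fix x assume x: "x \<in> carrier (tensor_power n r s k)"
  have "scale (Poly_Mapping.lookup x is) (basis_vec is) \<in> orbit" if "is \<in> Poly_Mapping.keys x" for "is"
  proof (rule orbit_scale)
    have len: "length is = k" and "set is \<subseteq> {1..n}"
      using x that by (auto simp: tensor_power_carrier)
    then have "(!) is ` {..<k} \<subseteq> {1..n}"
      by (auto dest!: nth_mem)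
    then have "word_vec ((!) is) \<in> orbit"
      by (rule word_moves.all_words[OF word_moves_orbit])
    moreover have "map ((!) is) [0..<k] = is"
      using len map_nth by blast
    ultimately show "basis_vec is \<in> orbit"
      by (simp add: word_vec_def)
  qed
  then have "(\<Sum>is\<in>Poly_Mapping.keys x. scale (Poly_Mapping.lookup x is) (basis_vec is)) \<in> orbit"
    by (rule orbit_sum)
  then show "x \<in> orbit"
    using basis_expansion[of x] by simp
qed

end

theorem lemma6p2:
  fixes r s :: "'k::alg_closed_field" and n k :: nat
  assumes "n > 0" and "r \<noteq> 0" and "s \<noteq> 0" and "r \<noteq> s"
    and "k \<ge> 1" and "n \<ge> k"
  shows "cyclic_module_generated_by (U_gl n r s) (tensor_power n r s k)
           (pure_tensor (map basis_vec [1..<k + 1]))"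
proof -
  let ?V = "tensor_power n r s k" and ?x = "basis_vec [1..<k + 1] :: nat list \<Rightarrow>\<^sub>0 'k"
  interpret left_module "U_gl n r s" ?V
    using assms(2-4) by (rule left_module_tensor_power)
  have x: "?x \<in> carrier ?V"
    using assms(6) by (auto simp: tensor_power_carrier)
  \<comment> \<open>The other inclusion is closure of the module under the action.\<close>
  have "carrier ?V \<subseteq> {a \<odot>\<^bsub>?V\<^esub> ?x | a. a \<in> carrier (U_gl n r s)}"
  proof
    fix y assume "y \<in> carrier ?V"
    then obtain p where "p \<in> carrier (free_alg (gens n))" "y = act (rep (tpow_rep n r s k) p) ?x"
      using carrier_subset_orbit[OF assms(2,3,6)] by (auto simp: orbit_def[OF assms(2,3,6)])
    then show "y \<in> {a \<odot>\<^bsub>?V\<^esub> ?x | a. a \<in> carrier (U_gl n r s)}"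
      using smult_coset[OF assms(2-4) _ x] by (auto simp: U_gl_carrier intro!: exI[of _ "coset n r s p"])
  qed
  then show ?thesis
    unfolding cyclic_module_generated_by_def pure_tensor_basis_vec
    using x smult_closed by (auto simp: left_module_axioms)
qed

end
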